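(* Let $L$ be a finite-dimensional solvable Lie algebra over a field $F$. If $M$ is a maximal subalgebra of $L$ for which $M_L$ is strongly nilregular, then $n(M)=n(L)-i$ where $i \in \{0,1\}$.
   Context: $N(L)$ is the nilradical of $L$; the upper nilpotent series is $N_0(L)=0$, $N_i(L)/N_{i-1}(L)=N(L/N_{i-1}(L))$, and the nilpotent length $n(L)$ is the smallest integer $m$ with $N_m(L)=L$. The core $M_L$ of a subalgebra $M$ of $L$ is the largest ideal of $L$ contained in $M$. The compatibility index of a subalgebra $U$ of $L$ is the largest integer $r$ such that $N_r(L)\subseteq U$. If $F$ has characteristic $p>0$, a subalgebra $U$ of compatibility index $r$ is strongly nilregular if $N_k(U)/N_{k-1}(U)$ has nilpotency class less than $p-1$ for $k=1,\ldots,r$ (a nilpotent algebra $K$ has class $c$ if $K^{c+1}=0$ but $K^c\neq 0$, where $K^1=K$, $K^{i+1}=[K^i,K]$). If $F$ has characteristic zero, every subalgebra of $L$ is regarded as (strongly) nilregular. *)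

theory Defs
  imports "HOL-Algebra.Algebra"
begin

text \<open>
  A Lie algebra \<open>L\<close> over \<open>F\<close> is carried by the record type of HOL-Algebra modules. The field
  \<^term>\<open>mult\<close> of the record is the Lie bracket; the field \<^term>\<open>one\<close> is never used.
\<close>

locale lie_algebra = field F + module F L
  for F :: "('k, 'm) ring_scheme" (structure) and L :: "('k, 'a) module" (structure) +
  assumes bracket_closed:
      "\<lbrakk>x \<in> carrier L; y \<in> carrier L\<rbrakk> \<Longrightarrow> x \<otimes>\<^bsub>L\<^esub> y \<in> carrier L"
    and bracket_add_left:
      "\<lbrakk>x \<in> carrier L; y \<in> carrier L; z \<in> carrier L\<rbrakk> \<Longrightarrow>
        (x \<oplus>\<^bsub>L\<^esub> y) \<otimes>\<^bsub>L\<^esub> z = (x \<otimes>\<^bsub>L\<^esub> z) \<oplus>\<^bsub>L\<^esub> (y \<otimes>\<^bsub>L\<^esub> z)"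
    and bracket_add_right:
      "\<lbrakk>x \<in> carrier L; y \<in> carrier L; z \<in> carrier L\<rbrakk> \<Longrightarrow>
        x \<otimes>\<^bsub>L\<^esub> (y \<oplus>\<^bsub>L\<^esub> z) = (x \<otimes>\<^bsub>L\<^esub> y) \<oplus>\<^bsub>L\<^esub> (x \<otimes>\<^bsub>L\<^esub> z)"
    and bracket_smult_left:
      "\<lbrakk>a \<in> carrier F; x \<in> carrier L; y \<in> carrier L\<rbrakk> \<Longrightarrow>
        (a \<odot>\<^bsub>L\<^esub> x) \<otimes>\<^bsub>L\<^esub> y = a \<odot>\<^bsub>L\<^esub> (x \<otimes>\<^bsub>L\<^esub> y)"
    and bracket_smult_right:
      "\<lbrakk>a \<in> carrier F; x \<in> carrier L; y \<in> carrier L\<rbrakk> \<Longrightarrow>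
        x \<otimes>\<^bsub>L\<^esub> (a \<odot>\<^bsub>L\<^esub> y) = a \<odot>\<^bsub>L\<^esub> (x \<otimes>\<^bsub>L\<^esub> y)"
    and bracket_self:
      "x \<in> carrier L \<Longrightarrow> x \<otimes>\<^bsub>L\<^esub> x = \<zero>\<^bsub>L\<^esub>"
    and jacobi:
      "\<lbrakk>x \<in> carrier L; y \<in> carrier L; z \<in> carrier L\<rbrakk> \<Longrightarrow>
        (x \<otimes>\<^bsub>L\<^esub> (y \<otimes>\<^bsub>L\<^esub> z)) \<oplus>\<^bsub>L\<^esub> (y \<otimes>\<^bsub>L\<^esub> (z \<otimes>\<^bsub>L\<^esub> x)) \<oplus>\<^bsub>L\<^esub> (z \<otimes>\<^bsub>L\<^esub> (x \<otimes>\<^bsub>L\<^esub> y))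
          = \<zero>\<^bsub>L\<^esub>"

definition finite_dimensional :: "('k, 'm) ring_scheme \<Rightarrow> ('k, 'a) module \<Rightarrow> bool" where
  "finite_dimensional F L \<longleftrightarrow>
    (\<exists>B. finite B \<and> B \<subseteq> carrier L \<and>
      (\<forall>x\<in>carrier L. \<exists>c\<in>B \<rightarrow> carrier F. x = (\<Oplus>\<^bsub>L\<^esub>v\<in>B. c v \<odot>\<^bsub>L\<^esub> v)))"

text \<open>The additive order of the unit, which is \<open>0\<close> if that order is infinite.\<close>

definition field_char :: "('k, 'm) ring_scheme \<Rightarrow> nat" where
  "field_char F = group.ord (add_monoid F) \<one>\<^bsub>F\<^esub>"


definition lie_subalgebra :: "('k, 'm) ring_scheme \<Rightarrow> ('k, 'a) module \<Rightarrow> 'a set \<Rightarrow> bool" where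
  "lie_subalgebra F L U \<longleftrightarrow> submodule U F L \<and> (\<forall>x\<in>U. \<forall>y\<in>U. x \<otimes>\<^bsub>L\<^esub> y \<in> U)"

definition lie_ideal :: "('k, 'm) ring_scheme \<Rightarrow> ('k, 'a) module \<Rightarrow> 'a set \<Rightarrow> bool" where
  "lie_ideal F L I \<longleftrightarrow> submodule I F L \<and> (\<forall>x\<in>carrier L. \<forall>y\<in>I. x \<otimes>\<^bsub>L\<^esub> y \<in> I)"

definition maximal_subalgebra :: "('k, 'm) ring_scheme \<Rightarrow> ('k, 'a) module \<Rightarrow> 'a set \<Rightarrow> bool" where
  "maximal_subalgebra F L M \<longleftrightarrow>
    lie_subalgebra F L M \<and> M \<noteq> carrier L \<and>
    (\<forall>U. lie_subalgebra F L U \<longrightarrow> M \<subseteq> U \<longrightarrow> U = M \<or> U = carrier L)"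

definition sub_lie :: "('k, 'a) module \<Rightarrow> 'a set \<Rightarrow> ('k, 'a) module" where
  "sub_lie L U = L\<lparr>carrier := U\<rparr>"

text \<open>
  The quotient by an ideal, with the cosets as elements. The underlying additive group and the
  bracket of cosets are those of the quotient construction for rings, which does not refer to
  associativity or to a unit.
\<close>

definition quot_lie :: "('k, 'a) module \<Rightarrow> 'a set \<Rightarrow> ('k, 'a set) module" where
  "quot_lie L I =
    ring.extend (L Quot I) (module.fields (\<lambda>a A. \<Union>x\<in>A. I +>\<^bsub>L\<^esub> (a \<odot>\<^bsub>L\<^esub> x)))"


text \<open>The product \<open>[A,B]\<close> is the linear span of all brackets.\<close>

definition lie_product ::
  "('k, 'm) ring_scheme \<Rightarrow> ('k, 'a) module \<Rightarrow> 'a set \<Rightarrow> 'a set \<Rightarrow> 'a set" where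
  "lie_product F L A B = (\<lambda>U. submodule U F L) hull {x \<otimes>\<^bsub>L\<^esub> y | x y. x \<in> A \<and> y \<in> B}"

primrec derived_series :: "('k, 'm) ring_scheme \<Rightarrow> ('k, 'a) module \<Rightarrow> nat \<Rightarrow> 'a set" where
  "derived_series F L 0 = carrier L"
| "derived_series F L (Suc i) =
    lie_product F L (derived_series F L i) (derived_series F L i)"

definition lie_solvable :: "('k, 'm) ring_scheme \<Rightarrow> ('k, 'a) module \<Rightarrow> bool" where
  "lie_solvable F L \<longleftrightarrow> (\<exists>m. derived_series F L m = {\<zero>\<^bsub>L\<^esub>})"

text \<open>The indexing is shifted: index \<open>i\<close> denotes \<open>L\<^sup>i\<^sup>+\<^sup>1\<close>, where \<open>L\<^sup>1 = L\<close> and \<open>L\<^sup>i\<^sup>+\<^sup>1 = [L\<^sup>i, L]\<close>.\<close>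

primrec lower_central :: "('k, 'm) ring_scheme \<Rightarrow> ('k, 'a) module \<Rightarrow> nat \<Rightarrow> 'a set" where
  "lower_central F L 0 = carrier L"
| "lower_central F L (Suc i) = lie_product F L (lower_central F L i) (carrier L)"

definition lie_nilpotent :: "('k, 'm) ring_scheme \<Rightarrow> ('k, 'a) module \<Rightarrow> bool" where
  "lie_nilpotent F L \<longleftrightarrow> (\<exists>c. lower_central F L c = {\<zero>\<^bsub>L\<^esub>})"

text \<open>The class is \<open>c\<close> if \<open>L\<^sup>c\<^sup>+\<^sup>1 = 0\<close> but \<open>L\<^sup>c \<noteq> 0\<close>; the zero algebra has class \<open>0\<close>.\<close>

definition nilpotency_class :: "('k, 'm) ring_scheme \<Rightarrow> ('k, 'a) module \<Rightarrow> nat" where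
  "nilpotency_class F L = (LEAST c. lower_central F L c = {\<zero>\<^bsub>L\<^esub>})"


text \<open>
  In the following, \<^term>\<open>Greatest\<close> on sets refers to inclusion: the nilradical is the largest
  nilpotent ideal and the core is the largest ideal contained in \<open>M\<close>.
\<close>

definition nilradical :: "('k, 'm) ring_scheme \<Rightarrow> ('k, 'a) module \<Rightarrow> 'a set" where
  "nilradical F L = (GREATEST I. lie_ideal F L I \<and> lie_nilpotent F (sub_lie L I))"

definition lie_core :: "('k, 'm) ring_scheme \<Rightarrow> ('k, 'a) module \<Rightarrow> 'a set \<Rightarrow> 'a set" where
  "lie_core F L M = (GREATEST I. lie_ideal F L I \<and> I \<subseteq> M)"

text \<open>The successor step takes the preimage in \<open>L\<close> of the nilradical of \<open>L/N\<^sub>i(L)\<close>.\<close>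

primrec upper_nilpotent :: "('k, 'm) ring_scheme \<Rightarrow> ('k, 'a) module \<Rightarrow> nat \<Rightarrow> 'a set" where
  "upper_nilpotent F L 0 = {\<zero>\<^bsub>L\<^esub>}"
| "upper_nilpotent F L (Suc i) =
    {x \<in> carrier L. upper_nilpotent F L i +>\<^bsub>L\<^esub> x
                      \<in> nilradical F (quot_lie L (upper_nilpotent F L i))}"

definition nilpotent_length :: "('k, 'm) ring_scheme \<Rightarrow> ('k, 'a) module \<Rightarrow> nat" where
  "nilpotent_length F L = (LEAST m. upper_nilpotent F L m = carrier L)"

text \<open>
  For solvable \<open>L\<close>, the maximum exists exactly if \<open>U\<close> is a proper subalgebra.
\<close>

definition compatibility_index ::
  "('k, 'm) ring_scheme \<Rightarrow> ('k, 'a) module \<Rightarrow> 'a set \<Rightarrow> nat" where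
  "compatibility_index F L U = (GREATEST r. upper_nilpotent F L r \<subseteq> U)"

definition upper_nilpotent_factor ::
  "('k, 'm) ring_scheme \<Rightarrow> ('k, 'a) module \<Rightarrow> nat \<Rightarrow> ('k, 'a set) module" where
  "upper_nilpotent_factor F L k =
    quot_lie (sub_lie L (upper_nilpotent F L k)) (upper_nilpotent F L (k - 1))"

definition strongly_nilregular ::
  "('k, 'm) ring_scheme \<Rightarrow> ('k, 'a) module \<Rightarrow> 'a set \<Rightarrow> bool" where
  "strongly_nilregular F L U \<longleftrightarrow>
    (field_char F > 0 \<longrightarrow>
      (\<forall>k\<in>{1..compatibility_index F L U}.
        lie_nilpotent F (upper_nilpotent_factor F (sub_lie L U) k) \<and>
        nilpotency_class F (upper_nilpotent_factor F (sub_lie L U) k) < field_char F - 1))"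

end

theory Submission
  imports Defs
begin

text \<open>
  Nilpotency of an ideal \<open>J\<close> modulo an ideal \<open>Z\<close> is expressed by iterated brackets
  \<open>[x\<^sub>1, [x\<^sub>2, \<dots> [x\<^sub>n, v]]]\<close> lying in \<open>Z\<close>, so that all arguments take place inside \<open>L\<close>.

  Let \<open>K\<close> be the core of \<open>M\<close> and \<open>r\<close> its compatibility index, so that \<open>L = M + N\<^sub>r\<^sub>+\<^sub>1(L)\<close>. A derivation
  preserves the nilradical if its class is less than \<open>p - 1\<close>, hence \<open>N\<^sub>k(K) = N\<^sub>k(L)\<close> for \<open>k \<le> r\<close>.
  For \<open>k < r\<close> it follows that \<open>N\<^sub>k(M)\<close> centralizes \<open>N\<^sub>k\<^sub>+\<^sub>1(L)\<close> modulo \<open>N\<^sub>k(L)\<close>, which forces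
  \<open>N\<^sub>k(M) = N\<^sub>k(L)\<close>. Next, \<open>N\<^sub>r(M)\<close> acts nilpotently on \<open>N\<^sub>r(L)/N\<^sub>r\<^sub>-\<^sub>1(L)\<close>, hence by commutators on
  \<open>L/N\<^sub>r(L)\<close>, and therefore lies in \<open>N\<^sub>r\<^sub>+\<^sub>1(L)\<close>. As \<open>M\<close> supplements \<open>N\<^sub>r\<^sub>+\<^sub>1(L)\<close>, this propagates to
  \<open>N\<^sub>k(M) \<subseteq> N\<^sub>k\<^sub>+\<^sub>1(L)\<close> for all \<open>k \<ge> r\<close>, so \<open>n(L) \<le> n(M) + 1\<close>. The bound \<open>n(M) \<le> n(L)\<close> holds because
  \<open>N\<^sub>k(L) \<inter> M \<subseteq> N\<^sub>k(M)\<close>.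
\<close>

section \<open>Submodules and ideals\<close>

text \<open>The obstacle is characteristic p: there a derivation can move the nilradical out of
  itself, so the nilradical of the ideal K need not be an ideal of L. The hypothesis on K enters at
  this point alone. Class c makes words with c + 1 letters from the nilradical vanish on the whole
  algebra, and differentiating such a word c + 1 times produces the factors 1, ..., c + 1, which
  have to be invertible; hence c < p - 1. The second pillar is that solvability makes N_{k+1}(L)
  contain every element centralizing N_{k+1}(L)/N_k(L). For k < r the bracket of N_k(M) with
  N_{k+1}(L) lies in N_k(M) and in K, hence in N_k(K) = N_k(L). At level r this breaks down, since
  N_{r+1}(L) is not contained in M. Only the action on the factor below remains, and it yields an
  inclusion in N_{r+1}(L) instead of an equality. This one step is the possible difference of the
  two lengths.\<close>

context lie_algebra
begin

lemma submoduleD: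
  assumes "submodule U F L"
  shows "U \<subseteq> carrier L" "x \<in> U \<Longrightarrow> x \<in> carrier L" "\<zero>\<^bsub>L\<^esub> \<in> U"
    "x \<in> U \<Longrightarrow> y \<in> U \<Longrightarrow> x \<oplus>\<^bsub>L\<^esub> y \<in> U"
    "x \<in> U \<Longrightarrow> \<ominus>\<^bsub>L\<^esub> x \<in> U"
    "a \<in> carrier F \<Longrightarrow> x \<in> U \<Longrightarrow> a \<odot>\<^bsub>L\<^esub> x \<in> U"
proof -
  show "U \<subseteq> carrier L" "x \<in> U \<Longrightarrow> x \<in> carrier L" "x \<in> U \<Longrightarrow> y \<in> U \<Longrightarrow> x \<oplus>\<^bsub>L\<^esub> y \<in> U"
    "x \<in> U \<Longrightarrow> \<ominus>\<^bsub>L\<^esub> x \<in> U" "a \<in> carrier F \<Longrightarrow> x \<in> U \<Longrightarrow> a \<odot>\<^bsub>L\<^esub> x \<in> U"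
    using submoduleE[OF assms] by auto
  show "\<zero>\<^bsub>L\<^esub> \<in> U"
    using submodule.axioms(1)[OF assms] subgroup.one_closed by fastforce
qed

lemma smult_minus_one: "x \<in> carrier L \<Longrightarrow> (\<ominus> \<one>) \<odot>\<^bsub>L\<^esub> x = \<ominus>\<^bsub>L\<^esub> x"
  using smult_l_minus[of \<one> x] by simp

lemma submoduleI':
  assumes "U \<subseteq> carrier L" "\<zero>\<^bsub>L\<^esub> \<in> U"
    and "\<And>x y. x \<in> U \<Longrightarrow> y \<in> U \<Longrightarrow> x \<oplus>\<^bsub>L\<^esub> y \<in> U"
    and "\<And>a x. a \<in> carrier F \<Longrightarrow> x \<in> U \<Longrightarrow> a \<odot>\<^bsub>L\<^esub> x \<in> U"
  shows "submodule U F L"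
proof (rule submoduleI)
  fix x assume "x \<in> U"
  then show "\<ominus>\<^bsub>L\<^esub> x \<in> U"
    using assms(1) assms(4)[of "\<ominus> \<one>" x] smult_minus_one by auto
qed (use assms in auto)

lemma submodule_zero: "submodule {\<zero>\<^bsub>L\<^esub>} F L"
  by (rule submoduleI') auto

lemma submodule_Inter:
  assumes "T \<noteq> {}" "\<And>U. U \<in> T \<Longrightarrow> submodule U F L"
  shows "submodule (\<Inter>T) F L"
proof (rule submoduleI')
  show "\<Inter>T \<subseteq> carrier L" using assms submoduleD(1) by blast
qed (use assms(2)[THEN submoduleD(3)] assms(2)[THEN submoduleD(4)] assms(2)[THEN submoduleD(6)] in auto)

lemma submodule_Int: "submodule U F L \<Longrightarrow> submodule V F L \<Longrightarrow> submodule (U \<inter> V) F L"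
  using submodule_Inter[of "{U, V}"] by auto

lemma submodule_hull:
  assumes "S \<subseteq> carrier L"
  shows "submodule ((\<lambda>U. submodule U F L) hull S) F L"
  unfolding hull_def using assms carrier_is_submodule by (intro submodule_Inter) auto

lemma set_add_iff: "x \<in> U <+>\<^bsub>L\<^esub> V \<longleftrightarrow> (\<exists>u\<in>U. \<exists>v\<in>V. x = u \<oplus>\<^bsub>L\<^esub> v)"
  unfolding set_add_def' by auto

lemma submodule_set_add:
  assumes U: "submodule U F L" and V: "submodule V F L"
  shows "submodule (U <+>\<^bsub>L\<^esub> V) F L"
proof (rule submoduleI')
  show "U <+>\<^bsub>L\<^esub> V \<subseteq> carrier L"
    using submoduleD[OF U] submoduleD[OF V] by (auto simp: set_add_iff)
  show "\<zero>\<^bsub>L\<^esub> \<in> U <+>\<^bsub>L\<^esub> V"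
    unfolding set_add_iff using submoduleD(3)[OF U] submoduleD(3)[OF V]
    by (intro bexI[of _ "\<zero>\<^bsub>L\<^esub>"]) auto
next
  fix x y assume "x \<in> U <+>\<^bsub>L\<^esub> V" "y \<in> U <+>\<^bsub>L\<^esub> V"
  then obtain u v u' v' where *: "u \<in> U" "v \<in> V" "u' \<in> U" "v' \<in> V"
    "x = u \<oplus>\<^bsub>L\<^esub> v" "y = u' \<oplus>\<^bsub>L\<^esub> v'" unfolding set_add_iff by blast
  then have "x \<oplus>\<^bsub>L\<^esub> y = (u \<oplus>\<^bsub>L\<^esub> u') \<oplus>\<^bsub>L\<^esub> (v \<oplus>\<^bsub>L\<^esub> v')"
    using submoduleD(2)[OF U] submoduleD(2)[OF V] by (simp add: M.a_ac)
  then show "x \<oplus>\<^bsub>L\<^esub> y \<in> U <+>\<^bsub>L\<^esub> V"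
    unfolding set_add_iff using * submoduleD(4)[OF U] submoduleD(4)[OF V] by blast
next
  fix a x assume a: "a \<in> carrier F" and "x \<in> U <+>\<^bsub>L\<^esub> V"
  then obtain u v where *: "u \<in> U" "v \<in> V" "x = u \<oplus>\<^bsub>L\<^esub> v" unfolding set_add_iff by blast
  then have "a \<odot>\<^bsub>L\<^esub> x = a \<odot>\<^bsub>L\<^esub> u \<oplus>\<^bsub>L\<^esub> a \<odot>\<^bsub>L\<^esub> v"
    using a submoduleD(2)[OF U] submoduleD(2)[OF V] smult_r_distr by simp
  then show "a \<odot>\<^bsub>L\<^esub> x \<in> U <+>\<^bsub>L\<^esub> V"
    unfolding set_add_iff using a * submoduleD(6)[OF U] submoduleD(6)[OF V] by blast
qed

lemma set_add_upper:
  assumes "submodule U F L" "submodule V F L"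
  shows "U \<subseteq> U <+>\<^bsub>L\<^esub> V" "V \<subseteq> U <+>\<^bsub>L\<^esub> V"
proof -
  show "U \<subseteq> U <+>\<^bsub>L\<^esub> V"
  proof
    fix u assume "u \<in> U"
    then have "u = u \<oplus>\<^bsub>L\<^esub> \<zero>\<^bsub>L\<^esub>" using submoduleD(2)[OF assms(1)] by simp
    then show "u \<in> U <+>\<^bsub>L\<^esub> V" unfolding set_add_iff using \<open>u \<in> U\<close> submoduleD(3)[OF assms(2)] by blast
  qed
  show "V \<subseteq> U <+>\<^bsub>L\<^esub> V"
  proof
    fix v assume "v \<in> V"
    then have "v = \<zero>\<^bsub>L\<^esub> \<oplus>\<^bsub>L\<^esub> v" using submoduleD(2)[OF assms(2)] by simp
    then show "v \<in> U <+>\<^bsub>L\<^esub> V" unfolding set_add_iff using \<open>v \<in> V\<close> submoduleD(3)[OF assms(1)] by blast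
  qed
qed

lemma set_add_least:
  assumes "submodule W F L" "U \<subseteq> W" "V \<subseteq> W"
  shows "U <+>\<^bsub>L\<^esub> V \<subseteq> W"
  using assms submoduleD(4)[OF assms(1)] by (force simp: set_add_iff)

section \<open>Identities of the bracket, and ideals\<close>

lemma bracket_zero_left [simp]: "x \<in> carrier L \<Longrightarrow> \<zero>\<^bsub>L\<^esub> \<otimes>\<^bsub>L\<^esub> x = \<zero>\<^bsub>L\<^esub>"
  using bracket_smult_left[of \<zero> "\<zero>\<^bsub>L\<^esub>" x] bracket_closed by simp

lemma bracket_zero_right [simp]: "x \<in> carrier L \<Longrightarrow> x \<otimes>\<^bsub>L\<^esub> \<zero>\<^bsub>L\<^esub> = \<zero>\<^bsub>L\<^esub>"
  using bracket_smult_right[of \<zero> x "\<zero>\<^bsub>L\<^esub>"] bracket_closed by simp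

lemma bracket_minus_right:
  "x \<in> carrier L \<Longrightarrow> y \<in> carrier L \<Longrightarrow> x \<otimes>\<^bsub>L\<^esub> (\<ominus>\<^bsub>L\<^esub> y) = \<ominus>\<^bsub>L\<^esub> (x \<otimes>\<^bsub>L\<^esub> y)"
  using bracket_smult_right[of "\<ominus> \<one>" x y] bracket_closed by (simp add: smult_minus_one)

lemma bracket_anticomm:
  assumes "x \<in> carrier L" "y \<in> carrier L"
  shows "x \<otimes>\<^bsub>L\<^esub> y = \<ominus>\<^bsub>L\<^esub> (y \<otimes>\<^bsub>L\<^esub> x)"
proof -
  have "\<zero>\<^bsub>L\<^esub> = (x \<oplus>\<^bsub>L\<^esub> y) \<otimes>\<^bsub>L\<^esub> (x \<oplus>\<^bsub>L\<^esub> y)"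
    using assms bracket_self[of "x \<oplus>\<^bsub>L\<^esub> y"] by simp
  also have "\<dots> = x \<otimes>\<^bsub>L\<^esub> y \<oplus>\<^bsub>L\<^esub> y \<otimes>\<^bsub>L\<^esub> x"
    using assms by (simp add: bracket_add_left bracket_add_right bracket_closed bracket_self[of x] bracket_self[of y] M.a_comm)
  finally show ?thesis
    using assms bracket_closed M.minus_equality[of "x \<otimes>\<^bsub>L\<^esub> y" "y \<otimes>\<^bsub>L\<^esub> x"] by simp
qed

text \<open>This is the Jacobi identity in the form that ad x is a derivation. It is the derivation
  to which \<open>derivation_nil_ideal\<close> is applied later.\<close>

lemma bracket_leibniz:
  assumes "x \<in> carrier L" "y \<in> carrier L" "z \<in> carrier L"
  shows "x \<otimes>\<^bsub>L\<^esub> (y \<otimes>\<^bsub>L\<^esub> z) = (x \<otimes>\<^bsub>L\<^esub> y) \<otimes>\<^bsub>L\<^esub> z \<oplus>\<^bsub>L\<^esub> y \<otimes>\<^bsub>L\<^esub> (x \<otimes>\<^bsub>L\<^esub> z)"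
proof -
  have 1: "y \<otimes>\<^bsub>L\<^esub> (z \<otimes>\<^bsub>L\<^esub> x) = \<ominus>\<^bsub>L\<^esub> (y \<otimes>\<^bsub>L\<^esub> (x \<otimes>\<^bsub>L\<^esub> z))"
    using assms bracket_anticomm[of z x] by (simp add: bracket_minus_right bracket_closed)
  have 2: "z \<otimes>\<^bsub>L\<^esub> (x \<otimes>\<^bsub>L\<^esub> y) = \<ominus>\<^bsub>L\<^esub> ((x \<otimes>\<^bsub>L\<^esub> y) \<otimes>\<^bsub>L\<^esub> z)"
    using assms bracket_anticomm[of z "x \<otimes>\<^bsub>L\<^esub> y"] by (simp add: bracket_closed)
  define a b c where "a = x \<otimes>\<^bsub>L\<^esub> (y \<otimes>\<^bsub>L\<^esub> z)" "b = y \<otimes>\<^bsub>L\<^esub> (x \<otimes>\<^bsub>L\<^esub> z)" "c = (x \<otimes>\<^bsub>L\<^esub> y) \<otimes>\<^bsub>L\<^esub> z"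
  have cl: "a \<in> carrier L" "b \<in> carrier L" "c \<in> carrier L"
    unfolding a_b_c_def using assms by (simp_all add: bracket_closed)
  have "a \<oplus>\<^bsub>L\<^esub> \<ominus>\<^bsub>L\<^esub> b \<oplus>\<^bsub>L\<^esub> \<ominus>\<^bsub>L\<^esub> c = \<zero>\<^bsub>L\<^esub>"
    using jacobi[OF assms] unfolding 1 2 a_b_c_def by simp
  then have "a \<oplus>\<^bsub>L\<^esub> \<ominus>\<^bsub>L\<^esub> (c \<oplus>\<^bsub>L\<^esub> b) = \<zero>\<^bsub>L\<^esub>"
    using cl by (simp add: M.minus_add M.a_ac)
  then have "a = c \<oplus>\<^bsub>L\<^esub> b"
    using cl M.minus_equality[of a "\<ominus>\<^bsub>L\<^esub> (c \<oplus>\<^bsub>L\<^esub> b)"] by simp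
  then show ?thesis unfolding a_b_c_def .
qed

lemma lie_idealD:
  assumes "lie_ideal F L I"
  shows "submodule I F L" "I \<subseteq> carrier L"
    "x \<in> carrier L \<Longrightarrow> y \<in> I \<Longrightarrow> x \<otimes>\<^bsub>L\<^esub> y \<in> I"
    "x \<in> I \<Longrightarrow> y \<in> carrier L \<Longrightarrow> x \<otimes>\<^bsub>L\<^esub> y \<in> I"
proof -
  show 1: "submodule I F L" "I \<subseteq> carrier L"
    and 2: "\<And>x y. x \<in> carrier L \<Longrightarrow> y \<in> I \<Longrightarrow> x \<otimes>\<^bsub>L\<^esub> y \<in> I"
    using assms submoduleD(1) unfolding lie_ideal_def by auto
  show "x \<in> I \<Longrightarrow> y \<in> carrier L \<Longrightarrow> x \<otimes>\<^bsub>L\<^esub> y \<in> I"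
    using 2[of y x] submoduleD(5)[OF 1(1)] bracket_anticomm[of x y] 1(2) by auto
qed

lemma lie_ideal_zero: "lie_ideal F L {\<zero>\<^bsub>L\<^esub>}"
  unfolding lie_ideal_def using submodule_zero by auto

lemma lie_ideal_carrier: "lie_ideal F L (carrier L)"
  unfolding lie_ideal_def using carrier_is_submodule bracket_closed by auto

lemma lie_ideal_Int: "lie_ideal F L I \<Longrightarrow> lie_ideal F L J \<Longrightarrow> lie_ideal F L (I \<inter> J)"
  unfolding lie_ideal_def using submodule_Int by auto

lemma lie_ideal_set_add:
  assumes "lie_ideal F L I" "lie_ideal F L J"
  shows "lie_ideal F L (I <+>\<^bsub>L\<^esub> J)"
  unfolding lie_ideal_def
proof (intro conjI ballI)
  show "submodule (I <+>\<^bsub>L\<^esub> J) F L"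
    using assms lie_idealD(1) submodule_set_add by blast
  fix x y assume x: "x \<in> carrier L" and "y \<in> I <+>\<^bsub>L\<^esub> J"
  then obtain i j where *: "i \<in> I" "j \<in> J" "y = i \<oplus>\<^bsub>L\<^esub> j" unfolding set_add_iff by blast
  then have "x \<otimes>\<^bsub>L\<^esub> y = x \<otimes>\<^bsub>L\<^esub> i \<oplus>\<^bsub>L\<^esub> x \<otimes>\<^bsub>L\<^esub> j"
    using x lie_idealD(2)[OF assms(1)] lie_idealD(2)[OF assms(2)] bracket_add_right by blast
  then show "x \<otimes>\<^bsub>L\<^esub> y \<in> I <+>\<^bsub>L\<^esub> J"
    unfolding set_add_iff using x * lie_idealD(3)[OF assms(1)] lie_idealD(3)[OF assms(2)] by blast
qed

lemma lie_ideal_is_subalgebra: "lie_ideal F L I \<Longrightarrow> lie_subalgebra F L I"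
  unfolding lie_subalgebra_def using lie_idealD by blast

lemma lie_product_submodule:
  assumes "A \<subseteq> carrier L" "B \<subseteq> carrier L"
  shows "submodule (lie_product F L A B) F L"
  unfolding lie_product_def using assms bracket_closed by (intro submodule_hull) blast

lemma lie_product_mem: "x \<in> A \<Longrightarrow> y \<in> B \<Longrightarrow> x \<otimes>\<^bsub>L\<^esub> y \<in> lie_product F L A B"
  unfolding lie_product_def by (rule hull_inc) blast

lemma lie_product_least:
  assumes "submodule V F L" "\<And>x y. x \<in> A \<Longrightarrow> y \<in> B \<Longrightarrow> x \<otimes>\<^bsub>L\<^esub> y \<in> V"
  shows "lie_product F L A B \<subseteq> V"
  unfolding lie_product_def using assms by (intro hull_minimal) auto

text \<open>A product of subspaces is a hull, so a property of its elements can be tested on the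
  generating brackets only if the property itself defines a subspace.
  \<open>submodule_word_preimage\<close> serves the same purpose for whole words.\<close>

lemma submodule_bracket_preimage:
  assumes "submodule V F L" "x \<in> carrier L"
  shows "submodule {y \<in> carrier L. x \<otimes>\<^bsub>L\<^esub> y \<in> V} F L"
  using assms(2) submoduleD[OF assms(1)]
  by (intro submoduleI') (auto simp: bracket_add_right bracket_smult_right)

lemma lie_ideal_product:
  assumes I: "lie_ideal F L I" and J: "lie_ideal F L J"
  shows "lie_ideal F L (lie_product F L I J)"
  unfolding lie_ideal_def
proof (intro conjI ballI)
  note cI = lie_idealD(2)[OF I] and cJ = lie_idealD(2)[OF J]
  show P: "submodule (lie_product F L I J) F L" using lie_product_submodule cI cJ by blast
  fix x y assume x: "x \<in> carrier L" and y: "y \<in> lie_product F L I J"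
  have "a \<otimes>\<^bsub>L\<^esub> b \<in> {y \<in> carrier L. x \<otimes>\<^bsub>L\<^esub> y \<in> lie_product F L I J}" if "a \<in> I" "b \<in> J" for a b
  proof -
    have "x \<otimes>\<^bsub>L\<^esub> (a \<otimes>\<^bsub>L\<^esub> b) = (x \<otimes>\<^bsub>L\<^esub> a) \<otimes>\<^bsub>L\<^esub> b \<oplus>\<^bsub>L\<^esub> a \<otimes>\<^bsub>L\<^esub> (x \<otimes>\<^bsub>L\<^esub> b)"
      using that x cI cJ bracket_leibniz by blast
    moreover have "(x \<otimes>\<^bsub>L\<^esub> a) \<otimes>\<^bsub>L\<^esub> b \<in> lie_product F L I J" "a \<otimes>\<^bsub>L\<^esub> (x \<otimes>\<^bsub>L\<^esub> b) \<in> lie_product F L I J"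
      using that x lie_idealD(3)[OF I] lie_idealD(3)[OF J] by (auto intro: lie_product_mem)
    moreover have "a \<otimes>\<^bsub>L\<^esub> b \<in> carrier L" using that cI cJ bracket_closed by blast
    ultimately show ?thesis using submoduleD(4)[OF P] by simp
  qed
  then have "lie_product F L I J \<subseteq> {y \<in> carrier L. x \<otimes>\<^bsub>L\<^esub> y \<in> lie_product F L I J}"
    using submodule_bracket_preimage[OF P x] by (intro lie_product_least) auto
  then show "x \<otimes>\<^bsub>L\<^esub> y \<in> lie_product F L I J" using y by auto
qed

end

section \<open>Restriction to a subalgebra\<close>

lemma sub_lie_simps [simp]:
  "carrier (sub_lie L U) = U" "monoid.mult (sub_lie L U) = monoid.mult L" "ring.add (sub_lie L U) = ring.add L"
  "ring.zero (sub_lie L U) = ring.zero L" "module.smult (sub_lie L U) = module.smult L"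
  "sub_lie (sub_lie L U) V = sub_lie L V"
  unfolding sub_lie_def by simp_all

context lie_algebra
begin

lemma sub_lie_algebra:
  assumes "lie_subalgebra F L U"
  shows "lie_algebra F (sub_lie L U)"
proof -
  have U: "submodule U F L" "\<And>x y. x \<in> U \<Longrightarrow> y \<in> U \<Longrightarrow> x \<otimes>\<^bsub>L\<^esub> y \<in> U"
    using assms unfolding lie_subalgebra_def by auto
  interpret S: module F "sub_lie L U"
    unfolding sub_lie_def using submodule.submodule_is_module[OF U(1)] module_axioms by blast
  show ?thesis
    by unfold_locales
      (use U(2) submoduleD(2)[OF U(1)] in \<open>auto simp: bracket_add_left bracket_add_right
        bracket_smult_left bracket_smult_right bracket_self jacobi\<close>)
qed

lemma submodule_sub_lie_iff:
  assumes "submodule U F L"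
  shows "submodule V F (sub_lie L U) \<longleftrightarrow> submodule V F L \<and> V \<subseteq> U"
proof -
  interpret S: module F "sub_lie L U"
    unfolding sub_lie_def using submodule.submodule_is_module[OF assms] module_axioms by blast
  show ?thesis
  proof
    assume V: "submodule V F (sub_lie L U)"
    have VU: "V \<subseteq> U" and ne: "V \<noteq> {}" and ad: "\<And>x y. x \<in> V \<Longrightarrow> y \<in> V \<Longrightarrow> x \<oplus>\<^bsub>L\<^esub> y \<in> V"
      and sm: "\<And>a x. a \<in> carrier F \<Longrightarrow> x \<in> V \<Longrightarrow> a \<odot>\<^bsub>L\<^esub> x \<in> V"
      using S.submoduleE[OF V] by auto
    obtain v where "v \<in> V" using ne by blast
    then have "\<zero> \<odot>\<^bsub>L\<^esub> v \<in> V" "v \<in> carrier L" using sm VU submoduleD(1)[OF assms] by auto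
    then have "\<zero>\<^bsub>L\<^esub> \<in> V" by simp
    then show "submodule V F L \<and> V \<subseteq> U"
      using VU ad sm submoduleD(1)[OF assms] by (intro conjI submoduleI') auto
  next
    assume V: "submodule V F L \<and> V \<subseteq> U"
    then have "submodule V F L" by blast
    note V' = submoduleD[OF this]
    have "V \<subseteq> carrier (sub_lie L U)" using V by simp
    \<comment> \<open>The negative in the restricted structure is an inverse taken with respect to
      another carrier. Writing it as multiplication by -1, an operation shared with
      \<open>L\<close>, settles it.\<close>
    moreover have "\<ominus>\<^bsub>sub_lie L U\<^esub> x \<in> V" if "x \<in> V" for x
    proof -
      have "\<ominus>\<^bsub>sub_lie L U\<^esub> x = (\<ominus> \<one>) \<odot>\<^bsub>sub_lie L U\<^esub> x"
        using S.smult_l_minus[of \<one> x] S.smult_one[of x] that V by auto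
      then show ?thesis using V'(6)[of "\<ominus> \<one>" x] that by simp
    qed
    ultimately show "submodule V F (sub_lie L U)"
      using V' by (intro S.submoduleI) auto
  qed
qed

lemma lie_ideal_sub_lie:
  assumes "lie_ideal F L I" "I \<subseteq> U" "submodule U F L"
  shows "lie_ideal F (sub_lie L U) I"
  using assms lie_idealD[OF assms(1)] submoduleD(1)[OF assms(3)]
  unfolding lie_ideal_def submodule_sub_lie_iff[OF assms(3)] by auto

end

section \<open>Iterated brackets and lower central series\<close>

definition bracket_word :: "('k, 'a) module \<Rightarrow> 'a list \<Rightarrow> 'a \<Rightarrow> 'a" where
  "bracket_word L xs v = foldr (\<lambda>x y. x \<otimes>\<^bsub>L\<^esub> y) xs v"

lemma bracket_word_simps [simp]:
  "bracket_word L [] v = v"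
  "bracket_word L (x # xs) v = x \<otimes>\<^bsub>L\<^esub> bracket_word L xs v"
  "bracket_word L (xs @ ys) v = bracket_word L xs (bracket_word L ys v)"
  "bracket_word (sub_lie L U) xs v = bracket_word L xs v"
  unfolding bracket_word_def by simp_all

text \<open>Acting set, space and target are kept apart so that one notion covers both nilpotency of
  an ideal modulo \<open>Z\<close> (the case \<open>A = V\<close>) and the nilpotent action of a
  mere set on \<open>L\<close> or on a factor.\<close>

definition drives :: "('k, 'a) module \<Rightarrow> 'a set \<Rightarrow> 'a set \<Rightarrow> 'a set \<Rightarrow> bool" where
  "drives L A V Z \<longleftrightarrow>
    (\<exists>n. \<forall>xs v. set xs \<subseteq> A \<longrightarrow> length xs = n \<longrightarrow> v \<in> V \<longrightarrow> bracket_word L xs v \<in> Z)"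

lemma drivesI:
  assumes "\<And>xs v. set xs \<subseteq> A \<Longrightarrow> length xs = n \<Longrightarrow> v \<in> V \<Longrightarrow> bracket_word L xs v \<in> Z"
  shows "drives L A V Z"
  unfolding drives_def using assms by blast

text \<open>Words do not mention the carrier. Hence nilpotency statements proved in \<open>M\<close>
  or in its core can be read in \<open>L\<close> without translation.\<close>

lemma drives_sub_lie [simp]: "drives (sub_lie L U) = drives L"
  unfolding drives_def fun_eq_iff by simp

lemma drives_mono:
  assumes "drives L A V Z" "A' \<subseteq> A" "V' \<subseteq> V" "Z \<subseteq> Z'"
  shows "drives L A' V' Z'"
  using assms unfolding drives_def by (meson subset_iff subset_trans)

lemma drives_trans:
  assumes "drives L A U V" "drives L A V W"
  shows "drives L A U W"
proof -
  obtain m n where m: "\<And>xs v. set xs \<subseteq> A \<Longrightarrow> length xs = m \<Longrightarrow> v \<in> U \<Longrightarrow> bracket_word L xs v \<in> V"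
    and n: "\<And>xs v. set xs \<subseteq> A \<Longrightarrow> length xs = n \<Longrightarrow> v \<in> V \<Longrightarrow> bracket_word L xs v \<in> W"
    using assms unfolding drives_def by metis
  show ?thesis
  proof (rule drivesI)
    fix xs v assume xs: "set xs \<subseteq> A" "length xs = n + m" "v \<in> U"
    have "bracket_word L (drop n xs) v \<in> V"
      using xs set_drop_subset[of n xs] by (intro m) auto
    then have "bracket_word L (take n xs) (bracket_word L (drop n xs) v) \<in> W"
      using xs set_take_subset[of n xs] by (intro n) auto
    then show "bracket_word L xs v \<in> W"
      by (metis append_take_drop_id bracket_word_simps(3))
  qed
qed

lemma bracket_word_stable:
  assumes "\<And>x v. x \<in> A \<Longrightarrow> v \<in> V \<Longrightarrow> x \<otimes>\<^bsub>L\<^esub> v \<in> V" "set xs \<subseteq> A" "v \<in> V"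
  shows "bracket_word L xs v \<in> V"
  using assms(2) by (induction xs) (use assms in auto)

lemma drives_step:
  assumes "\<And>x v. x \<in> A \<Longrightarrow> v \<in> V \<Longrightarrow> x \<otimes>\<^bsub>L\<^esub> v \<in> W"
  shows "drives L A V W"
proof (rule drivesI)
  fix xs v assume "set xs \<subseteq> A" "length xs = 1" "v \<in> V"
  then show "bracket_word L xs v \<in> W" using assms by (auto simp: length_Suc_conv)
qed

context lie_algebra
begin

lemma bracket_word_closed:
  "set xs \<subseteq> carrier L \<Longrightarrow> v \<in> carrier L \<Longrightarrow> bracket_word L xs v \<in> carrier L"
  using bracket_word_stable[of "carrier L" "carrier L"] bracket_closed by blast

lemma bracket_word_ideal:
  "lie_ideal F L I \<Longrightarrow> set xs \<subseteq> carrier L \<Longrightarrow> v \<in> I \<Longrightarrow> bracket_word L xs v \<in> I"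
  using bracket_word_stable[of "carrier L" I] lie_idealD(3) by blast

lemma bracket_word_add:
  assumes "set xs \<subseteq> carrier L" "u \<in> carrier L" "v \<in> carrier L"
  shows "bracket_word L xs (u \<oplus>\<^bsub>L\<^esub> v) = bracket_word L xs u \<oplus>\<^bsub>L\<^esub> bracket_word L xs v"
  using assms(1) by (induction xs) (use assms in \<open>auto simp: bracket_add_right bracket_word_closed\<close>)

lemma bracket_word_smult:
  assumes "set xs \<subseteq> carrier L" "a \<in> carrier F" "v \<in> carrier L"
  shows "bracket_word L xs (a \<odot>\<^bsub>L\<^esub> v) = a \<odot>\<^bsub>L\<^esub> bracket_word L xs v"
  using assms(1) by (induction xs) (use assms in \<open>auto simp: bracket_smult_right bracket_word_closed\<close>)

lemma bracket_word_minus: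
  assumes "set xs \<subseteq> carrier L" "v \<in> carrier L"
  shows "bracket_word L xs (\<ominus>\<^bsub>L\<^esub> v) = \<ominus>\<^bsub>L\<^esub> bracket_word L xs v"
  using bracket_word_smult[OF assms(1), of "\<ominus> \<one>" v] assms bracket_word_closed
  by (simp add: smult_minus_one)

lemma submodule_word_preimage:
  assumes "submodule Z F L" "\<And>xs. xs \<in> W \<Longrightarrow> set xs \<subseteq> carrier L"
  shows "submodule {v \<in> carrier L. \<forall>xs\<in>W. bracket_word L xs v \<in> Z} F L"
proof (rule submoduleI')
  have "bracket_word L xs \<zero>\<^bsub>L\<^esub> = \<zero>\<^bsub>L\<^esub>" if "xs \<in> W" for xs
    using bracket_word_ideal[OF lie_ideal_zero assms(2)[OF that]] by auto
  then show "\<zero>\<^bsub>L\<^esub> \<in> {v \<in> carrier L. \<forall>xs\<in>W. bracket_word L xs v \<in> Z}"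
    using submoduleD(3)[OF assms(1)] by auto
qed (use assms submoduleD[OF assms(1)] in \<open>auto simp: bracket_word_add bracket_word_smult\<close>)

text \<open>Iterated brackets are multilinear in the letters.\<close>

lemma drives_set_add:
  assumes U: "U \<subseteq> carrier L" and V: "V \<subseteq> carrier L" and Y: "Y \<subseteq> carrier L"
    and Z: "submodule Z F L" and dr: "drives L (U \<union> V) Y Z"
  shows "drives L (U <+>\<^bsub>L\<^esub> V) Y Z"
proof -
  obtain n where n: "\<And>xs v. set xs \<subseteq> U \<union> V \<Longrightarrow> length xs = n \<Longrightarrow> v \<in> Y \<Longrightarrow> bracket_word L xs v \<in> Z"
    using dr unfolding drives_def by metis
  have UV: "U <+>\<^bsub>L\<^esub> V \<subseteq> carrier L" using U V M.a_closed by (fastforce simp: set_add_iff)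
  \<comment> \<open>The letters are split from left to right; \<open>ys\<close> holds those already
    replaced by a summand. Its length together with that of \<open>xs\<close> stays
    \<open>n\<close>, so the assumption applies once \<open>xs\<close> is empty.\<close>
  have *: "bracket_word L (ys @ xs) v \<in> Z"
    if "set xs \<subseteq> U <+>\<^bsub>L\<^esub> V" "set ys \<subseteq> U \<union> V" "length ys + length xs = n" "v \<in> Y" for xs ys v
    using that
  proof (induction xs arbitrary: ys)
    case Nil
    then show ?case using n by simp
  next
    case (Cons x xs)
    obtain a b where ab: "a \<in> U" "b \<in> V" "x = a \<oplus>\<^bsub>L\<^esub> b" using Cons.prems by (auto simp: set_add_iff)
    have abc: "a \<in> carrier L" "b \<in> carrier L" using ab U V by auto
    have ys: "set ys \<subseteq> carrier L" using Cons.prems U V by auto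
    have w: "bracket_word L xs v \<in> carrier L"
      using Cons.prems UV Y by (intro bracket_word_closed) auto
    have "bracket_word L (ys @ x # xs) v =
        bracket_word L ((ys @ [a]) @ xs) v \<oplus>\<^bsub>L\<^esub> bracket_word L ((ys @ [b]) @ xs) v"
      using ab abc w ys by (simp add: bracket_add_left bracket_word_add bracket_closed)
    moreover have "bracket_word L ((ys @ [a]) @ xs) v \<in> Z" "bracket_word L ((ys @ [b]) @ xs) v \<in> Z"
      by (rule Cons.IH; use Cons.prems ab in auto)+
    ultimately show ?case using submoduleD(4)[OF Z] by simp
  qed
  show ?thesis
    by (rule drivesI[of _ n]) (use *[of _ "[]"] in auto)
qed

lemma lower_central_submodule: "submodule (lower_central F L i) F L"
proof (induction i)
  case 0 then show ?case using carrier_is_submodule by simp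
next
  case (Suc i) then show ?case using lie_product_submodule submoduleD(1) by simp
qed

lemma bracket_word_lower_central:
  assumes "set xs \<subseteq> carrier L" "v \<in> carrier L"
  shows "bracket_word L xs v \<in> lower_central F L (length xs)"
  using assms(1)
proof (induction xs)
  case Nil then show ?case using assms by simp
next
  case (Cons x xs)
  let ?w = "bracket_word L xs v"
  have "?w \<otimes>\<^bsub>L\<^esub> x \<in> lower_central F L (length (x # xs))"
    using Cons by (auto intro: lie_product_mem)
  moreover have "x \<otimes>\<^bsub>L\<^esub> ?w = \<ominus>\<^bsub>L\<^esub> (?w \<otimes>\<^bsub>L\<^esub> x)"
    using Cons.prems assms(2) bracket_word_closed by (intro bracket_anticomm) auto
  ultimately show ?case using submoduleD(5)[OF lower_central_submodule[of "length (x # xs)"]] by simp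
qed

text \<open>The series descends while the words get shorter: a vector in term \<open>i\<close>
  already carries \<open>i\<close> brackets, so \<open>n - i\<close> further letters bring it into
  \<open>Z\<close>.\<close>

lemma lower_central_subset:
  assumes Z: "submodule Z F L"
    and n: "\<And>xs v. set xs \<subseteq> carrier L \<Longrightarrow> length xs = n \<Longrightarrow> v \<in> carrier L \<Longrightarrow> bracket_word L xs v \<in> Z"
  shows "lower_central F L n \<subseteq> Z"
proof -
  define W where "W k = {xs. set xs \<subseteq> carrier L \<and> length xs = k}" for k
  have "lower_central F L i \<subseteq> {v \<in> carrier L. \<forall>xs\<in>W (n - i). bracket_word L xs v \<in> Z}"
    if "i \<le> n" for i
    using that
  proof (induction i)
    case 0 then show ?case using n by (auto simp: W_def)
  next
    case (Suc i)
    have "submodule {v \<in> carrier L. \<forall>xs\<in>W (n - Suc i). bracket_word L xs v \<in> Z} F L"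
      using Z by (intro submodule_word_preimage) (auto simp: W_def)
    moreover have "bracket_word L xs (x \<otimes>\<^bsub>L\<^esub> y) \<in> Z"
      if x: "x \<in> lower_central F L i" and y: "y \<in> carrier L" and xs: "xs \<in> W (n - Suc i)" for x y xs
    proof -
      have xc: "x \<in> carrier L" using x submoduleD(1)[OF lower_central_submodule] by blast
      \<comment> \<open>The series brackets with \<open>L\<close> on the right, words on the left.
        Turning the bracket around makes \<open>y\<close> the last letter of the word, at the price
        of a sign.\<close>
      have "xs @ [y] \<in> W (n - i)" using xs y Suc.prems by (auto simp: W_def)
      then have "bracket_word L (xs @ [y]) x \<in> Z" using Suc x by (blast dest: Suc_leD)
      moreover have "bracket_word L xs (x \<otimes>\<^bsub>L\<^esub> y) = \<ominus>\<^bsub>L\<^esub> bracket_word L (xs @ [y]) x"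
        using xs xc y bracket_anticomm[OF xc y] by (auto simp: W_def bracket_word_minus bracket_closed)
      ultimately show ?thesis using submoduleD(5)[OF Z] by simp
    qed
    moreover have "x \<otimes>\<^bsub>L\<^esub> y \<in> carrier L" if "x \<in> lower_central F L i" "y \<in> carrier L" for x y
      using that submoduleD(2)[OF lower_central_submodule] bracket_closed by blast
    ultimately show ?case
      unfolding lower_central.simps by (intro lie_product_least) blast+
  qed
  from this[of n] show ?thesis by (auto simp: W_def)
qed

lemma lower_central_eq_zero_iff:
  "lower_central F L n = {\<zero>\<^bsub>L\<^esub>} \<longleftrightarrow>
    (\<forall>xs v. set xs \<subseteq> carrier L \<longrightarrow> length xs = n \<longrightarrow> v \<in> carrier L \<longrightarrow> bracket_word L xs v = \<zero>\<^bsub>L\<^esub>)"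
proof
  assume "lower_central F L n = {\<zero>\<^bsub>L\<^esub>}"
  then show "\<forall>xs v. set xs \<subseteq> carrier L \<longrightarrow> length xs = n \<longrightarrow> v \<in> carrier L \<longrightarrow> bracket_word L xs v = \<zero>\<^bsub>L\<^esub>"
    using bracket_word_lower_central by blast
next
  assume "\<forall>xs v. set xs \<subseteq> carrier L \<longrightarrow> length xs = n \<longrightarrow> v \<in> carrier L \<longrightarrow> bracket_word L xs v = \<zero>\<^bsub>L\<^esub>"
  then have "lower_central F L n \<subseteq> {\<zero>\<^bsub>L\<^esub>}"
    using lower_central_subset[OF submodule_zero] by blast
  then show "lower_central F L n = {\<zero>\<^bsub>L\<^esub>}"
    using submoduleD(3)[OF lower_central_submodule] by blast
qed

end

section \<open>Quotients\<close>

context lie_algebra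
begin

text \<open>The laws are identities and therefore survive under a surjection that respects the
  operations. For a quotient, only this compatibility is left to check.\<close>

lemma lie_algebra_image:
  assumes surj: "carrier Q = h ` carrier L"
    and zero: "\<zero>\<^bsub>Q\<^esub> = h \<zero>\<^bsub>L\<^esub>"
    and add: "\<And>x y. x \<in> carrier L \<Longrightarrow> y \<in> carrier L \<Longrightarrow> h x \<oplus>\<^bsub>Q\<^esub> h y = h (x \<oplus>\<^bsub>L\<^esub> y)"
    and mult: "\<And>x y. x \<in> carrier L \<Longrightarrow> y \<in> carrier L \<Longrightarrow> h x \<otimes>\<^bsub>Q\<^esub> h y = h (x \<otimes>\<^bsub>L\<^esub> y)"
    and smult: "\<And>a x. a \<in> carrier F \<Longrightarrow> x \<in> carrier L \<Longrightarrow> a \<odot>\<^bsub>Q\<^esub> h x = h (a \<odot>\<^bsub>L\<^esub> x)"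
  shows "lie_algebra F Q"
proof -
  have "abelian_group Q"
  proof (rule abelian_groupI)
    fix x assume "x \<in> carrier Q"
    then obtain u where "u \<in> carrier L" "x = h u" unfolding surj by auto
    then show "\<exists>y\<in>carrier Q. y \<oplus>\<^bsub>Q\<^esub> x = \<zero>\<^bsub>Q\<^esub>"
      unfolding surj by (intro bexI[of _ "h (\<ominus>\<^bsub>L\<^esub> u)"]) (auto simp: add zero M.l_neg)
  qed (auto simp: surj zero add M.a_ac)
  then interpret Q: module F Q
    by (intro moduleI module.axioms(1)[OF module_axioms])
      (auto simp: surj zero add smult smult_l_distr smult_r_distr smult_assoc1)
  show ?thesis
    by unfold_locales
      (auto simp: surj zero add smult mult bracket_closed bracket_add_left bracket_add_right
        bracket_smult_left bracket_smult_right bracket_self jacobi)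
qed

context
  fixes I
  assumes I: "lie_ideal F L I"
begin

lemma coset_iff: "w \<in> I +>\<^bsub>L\<^esub> x \<longleftrightarrow> (\<exists>z\<in>I. w = z \<oplus>\<^bsub>L\<^esub> x)"
  unfolding a_r_coset_def' by auto

lemma coset_absorb:
  assumes "z \<in> I" "x \<in> carrier L"
  shows "I +>\<^bsub>L\<^esub> (z \<oplus>\<^bsub>L\<^esub> x) = I +>\<^bsub>L\<^esub> x"
proof -
  note sI = submoduleD[OF lie_idealD(1)[OF I]]
  have zc: "z \<in> carrier L" using assms sI(2) by blast
  have 1: "h \<oplus>\<^bsub>L\<^esub> (z \<oplus>\<^bsub>L\<^esub> x) = (h \<oplus>\<^bsub>L\<^esub> z) \<oplus>\<^bsub>L\<^esub> x"
    "h \<oplus>\<^bsub>L\<^esub> x = (h \<oplus>\<^bsub>L\<^esub> \<ominus>\<^bsub>L\<^esub> z) \<oplus>\<^bsub>L\<^esub> (z \<oplus>\<^bsub>L\<^esub> x)" if "h \<in> I" for h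
  proof -
    have hc: "h \<in> carrier L" using that sI(2) by blast
    show "h \<oplus>\<^bsub>L\<^esub> (z \<oplus>\<^bsub>L\<^esub> x) = (h \<oplus>\<^bsub>L\<^esub> z) \<oplus>\<^bsub>L\<^esub> x" using hc zc assms by (simp add: M.a_ac)
    have "(h \<oplus>\<^bsub>L\<^esub> \<ominus>\<^bsub>L\<^esub> z) \<oplus>\<^bsub>L\<^esub> (z \<oplus>\<^bsub>L\<^esub> x) = h \<oplus>\<^bsub>L\<^esub> ((\<ominus>\<^bsub>L\<^esub> z \<oplus>\<^bsub>L\<^esub> z) \<oplus>\<^bsub>L\<^esub> x)"
      using hc zc assms by (simp only: M.a_assoc M.a_closed M.a_inv_closed)
    then show "h \<oplus>\<^bsub>L\<^esub> x = (h \<oplus>\<^bsub>L\<^esub> \<ominus>\<^bsub>L\<^esub> z) \<oplus>\<^bsub>L\<^esub> (z \<oplus>\<^bsub>L\<^esub> x)"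
      using zc assms by (simp add: M.l_neg)
  qed
  show ?thesis
  proof (intro equalityI subsetI)
    fix w assume "w \<in> I +>\<^bsub>L\<^esub> (z \<oplus>\<^bsub>L\<^esub> x)"
    then show "w \<in> I +>\<^bsub>L\<^esub> x" unfolding coset_iff using 1(1) sI(4)[OF _ assms(1)] by metis
  next
    fix w assume "w \<in> I +>\<^bsub>L\<^esub> x"
    then show "w \<in> I +>\<^bsub>L\<^esub> (z \<oplus>\<^bsub>L\<^esub> x)"
      unfolding coset_iff using 1(2) sI(4)[OF _ sI(5)[OF assms(1)]] by metis
  qed
qed

lemma coset_self: "x \<in> carrier L \<Longrightarrow> x \<in> I +>\<^bsub>L\<^esub> x"
  unfolding coset_iff using submoduleD(3)[OF lie_idealD(1)[OF I]]
  by (intro bexI[of _ "\<zero>\<^bsub>L\<^esub>"]) auto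

lemma coset_zero: "I +>\<^bsub>L\<^esub> \<zero>\<^bsub>L\<^esub> = I"
proof -
  have "h \<oplus>\<^bsub>L\<^esub> \<zero>\<^bsub>L\<^esub> = h" if "h \<in> I" for h using that lie_idealD(2)[OF I] by auto
  then show ?thesis unfolding a_r_coset_def' by auto
qed

lemma coset_eq_zero_iff: "x \<in> carrier L \<Longrightarrow> I +>\<^bsub>L\<^esub> x = I \<longleftrightarrow> x \<in> I"
  using coset_self coset_zero coset_absorb[of x "\<zero>\<^bsub>L\<^esub>"] by auto

lemma coset_add:
  assumes "x \<in> carrier L" "y \<in> carrier L"
  shows "I +>\<^bsub>L\<^esub> x <+>\<^bsub>L\<^esub> (I +>\<^bsub>L\<^esub> y) = I +>\<^bsub>L\<^esub> (x \<oplus>\<^bsub>L\<^esub> y)"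
proof -
  have "additive_subgroup I L"
    using submodule.axioms(1)[OF lie_idealD(1)[OF I]] by (rule additive_subgroup.intro)
  then have "abelian_subgroup I L" by (intro abelian_subgroupI3 module.axioms(2)[OF module_axioms])
  then show ?thesis by (rule abelian_subgroup.a_rcos_sum[OF _ assms])
qed

lemma quot_lie_simps:
  "carrier (quot_lie L I) = (\<lambda>x. I +>\<^bsub>L\<^esub> x) ` carrier L" "\<zero>\<^bsub>quot_lie L I\<^esub> = I"
  "\<And>x y. x \<in> carrier L \<Longrightarrow> y \<in> carrier L \<Longrightarrow>
    (I +>\<^bsub>L\<^esub> x) \<oplus>\<^bsub>quot_lie L I\<^esub> (I +>\<^bsub>L\<^esub> y) = I +>\<^bsub>L\<^esub> (x \<oplus>\<^bsub>L\<^esub> y)"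
  "\<And>x y. x \<in> carrier L \<Longrightarrow> y \<in> carrier L \<Longrightarrow>
    (I +>\<^bsub>L\<^esub> x) \<otimes>\<^bsub>quot_lie L I\<^esub> (I +>\<^bsub>L\<^esub> y) = I +>\<^bsub>L\<^esub> (x \<otimes>\<^bsub>L\<^esub> y)"
  "\<And>a x. a \<in> carrier F \<Longrightarrow> x \<in> carrier L \<Longrightarrow>
    a \<odot>\<^bsub>quot_lie L I\<^esub> (I +>\<^bsub>L\<^esub> x) = I +>\<^bsub>L\<^esub> (a \<odot>\<^bsub>L\<^esub> x)"
proof -
  note defs = quot_lie_def ring.defs module.defs FactRing_def
  note sI = submoduleD[OF lie_idealD(1)[OF I]]
  show "carrier (quot_lie L I) = (\<lambda>x. I +>\<^bsub>L\<^esub> x) ` carrier L"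
    unfolding defs by (auto simp: A_RCOSETS_def')
  show "\<zero>\<^bsub>quot_lie L I\<^esub> = I" unfolding defs by simp
  fix x assume x: "x \<in> carrier L"
  show "a \<odot>\<^bsub>quot_lie L I\<^esub> (I +>\<^bsub>L\<^esub> x) = I +>\<^bsub>L\<^esub> (a \<odot>\<^bsub>L\<^esub> x)" if a: "a \<in> carrier F" for a
  proof -
    \<comment> \<open>The record defines scalar multiples as a union over representatives; it
      collapses because all representatives yield the same coset. The bracket is treated likewise
      below.\<close>
    have "I +>\<^bsub>L\<^esub> (a \<odot>\<^bsub>L\<^esub> w) = I +>\<^bsub>L\<^esub> (a \<odot>\<^bsub>L\<^esub> x)" if w: "w \<in> I +>\<^bsub>L\<^esub> x" for w
    proof -
      obtain z where "z \<in> I" "w = z \<oplus>\<^bsub>L\<^esub> x" using w unfolding coset_iff by blast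
      then show ?thesis using coset_absorb a x sI(2,6) by (simp add: smult_r_distr)
    qed
    then have "(\<Union>w\<in>I +>\<^bsub>L\<^esub> x. I +>\<^bsub>L\<^esub> (a \<odot>\<^bsub>L\<^esub> w)) = I +>\<^bsub>L\<^esub> (a \<odot>\<^bsub>L\<^esub> x)"
      using coset_self[OF x] by (intro SUP_eq_const) blast+
    then show ?thesis unfolding defs by simp
  qed
  fix y assume y: "y \<in> carrier L"
  show "(I +>\<^bsub>L\<^esub> x) \<oplus>\<^bsub>quot_lie L I\<^esub> (I +>\<^bsub>L\<^esub> y) = I +>\<^bsub>L\<^esub> (x \<oplus>\<^bsub>L\<^esub> y)"
    unfolding defs using coset_add x y by simp
  have "I +>\<^bsub>L\<^esub> (v \<otimes>\<^bsub>L\<^esub> w) = I +>\<^bsub>L\<^esub> (x \<otimes>\<^bsub>L\<^esub> y)"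
    if v: "v \<in> I +>\<^bsub>L\<^esub> x" and w: "w \<in> I +>\<^bsub>L\<^esub> y" for v w
  proof -
    obtain z where z: "z \<in> I" "w = z \<oplus>\<^bsub>L\<^esub> y" using w unfolding coset_iff by blast
    obtain z' where z': "z' \<in> I" "v = z' \<oplus>\<^bsub>L\<^esub> x" using v unfolding coset_iff by blast
    have c: "z \<in> carrier L" "z' \<in> carrier L" using z z' sI(2) by auto
    have i: "v \<otimes>\<^bsub>L\<^esub> z \<in> I" "z' \<otimes>\<^bsub>L\<^esub> y \<in> I"
      using z z' c x y lie_idealD(3,4)[OF I] by auto
    have "v \<otimes>\<^bsub>L\<^esub> w = v \<otimes>\<^bsub>L\<^esub> z \<oplus>\<^bsub>L\<^esub> (z' \<otimes>\<^bsub>L\<^esub> y \<oplus>\<^bsub>L\<^esub> x \<otimes>\<^bsub>L\<^esub> y)"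
      using z z' c x y by (simp add: bracket_add_left bracket_add_right bracket_closed)
    then show ?thesis using coset_absorb i x y sI(2) bracket_closed by simp
  qed
  then have "rcoset_mult L I (I +>\<^bsub>L\<^esub> x) (I +>\<^bsub>L\<^esub> y) = I +>\<^bsub>L\<^esub> (x \<otimes>\<^bsub>L\<^esub> y)"
    unfolding rcoset_mult_def using coset_self[OF x] coset_self[OF y]
    by (intro SUP_eq_const) blast+
  then show "(I +>\<^bsub>L\<^esub> x) \<otimes>\<^bsub>quot_lie L I\<^esub> (I +>\<^bsub>L\<^esub> y) = I +>\<^bsub>L\<^esub> (x \<otimes>\<^bsub>L\<^esub> y)"
    unfolding defs by simp
qed

lemma quot_lie_algebra: "lie_algebra F (quot_lie L I)"
  by (rule lie_algebra_image[where h = "\<lambda>x. I +>\<^bsub>L\<^esub> x"]) (simp_all add: quot_lie_simps coset_zero)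

lemma bracket_word_quot:
  assumes "set xs \<subseteq> carrier L" "v \<in> carrier L"
  shows "bracket_word (quot_lie L I) (map (\<lambda>x. I +>\<^bsub>L\<^esub> x) xs) (I +>\<^bsub>L\<^esub> v) = I +>\<^bsub>L\<^esub> bracket_word L xs v"
  using assms(1) by (induction xs) (use assms in \<open>auto simp: quot_lie_simps bracket_word_closed\<close>)

text \<open>The dictionary between quotients and words. The length \<open>n\<close> stays explicit
  because the bound on the nilpotency class concerns this number and not merely its
  existence.\<close>

lemma lower_central_quot_eq_zero_iff:
  assumes J: "J \<subseteq> carrier L"
    and sub: "lie_subalgebra F (quot_lie L I) ((\<lambda>x. I +>\<^bsub>L\<^esub> x) ` J)"
  shows "lower_central F (sub_lie (quot_lie L I) ((\<lambda>x. I +>\<^bsub>L\<^esub> x) ` J)) n = {I} \<longleftrightarrow>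
    (\<forall>xs v. set xs \<subseteq> J \<longrightarrow> length xs = n \<longrightarrow> v \<in> J \<longrightarrow> bracket_word L xs v \<in> I)"
proof -
  interpret Q: lie_algebra F "quot_lie L I" by (rule quot_lie_algebra)
  interpret S: lie_algebra F "sub_lie (quot_lie L I) ((\<lambda>x. I +>\<^bsub>L\<^esub> x) ` J)"
    by (rule Q.sub_lie_algebra[OF sub])
  let ?p = "\<lambda>x. I +>\<^bsub>L\<^esub> x"
  have "(\<forall>xs v. set xs \<subseteq> ?p ` J \<longrightarrow> length xs = n \<longrightarrow> v \<in> ?p ` J \<longrightarrow>
      bracket_word (quot_lie L I) xs v = I) \<longleftrightarrow>
    (\<forall>xs v. set xs \<subseteq> J \<longrightarrow> length xs = n \<longrightarrow> v \<in> J \<longrightarrow> bracket_word L xs v \<in> I)" (is "?A \<longleftrightarrow> ?B")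
  proof
    assume A: ?A
    show ?B
    proof (intro allI impI)
      fix xs v assume xs: "set xs \<subseteq> J" "length xs = n" "v \<in> J"
      then have c: "set xs \<subseteq> carrier L" "v \<in> carrier L" using J by auto
      have "set (map ?p xs) \<subseteq> ?p ` J" "length (map ?p xs) = n" "?p v \<in> ?p ` J" using xs by auto
      then have "bracket_word (quot_lie L I) (map ?p xs) (?p v) = I" using A by blast
      then show "bracket_word L xs v \<in> I"
        using coset_eq_zero_iff[OF bracket_word_closed[OF c]] bracket_word_quot[OF c] by simp
    qed
  next
    assume B: ?B
    show ?A
    proof (intro allI impI)
      fix ys w assume ys: "set ys \<subseteq> ?p ` J" "length ys = n" "w \<in> ?p ` J"
      obtain v where v: "v \<in> J" "w = ?p v" using ys by auto
      \<comment> \<open>Via \<open>lists_image\<close>, representatives of all letters are chosen at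
        once.\<close>
      have "ys \<in> map ?p ` lists J" unfolding lists_image[symmetric] using ys(1) by blast
      then obtain xs where xs: "set xs \<subseteq> J" "ys = map ?p xs" by blast
      then have c: "set xs \<subseteq> carrier L" "v \<in> carrier L" using J v by auto
      have "bracket_word L xs v \<in> I" using B xs v ys by auto
      then show "bracket_word (quot_lie L I) ys w = I"
        using coset_eq_zero_iff[OF bracket_word_closed[OF c]] bracket_word_quot[OF c] xs v by simp
    qed
  qed
  then show ?thesis
    using S.lower_central_eq_zero_iff[of n] unfolding sub_lie_simps bracket_word_simps(4) quot_lie_simps(2)
    by (rule trans[rotated])
qed

section \<open>Correspondence between ideals of \<open>L\<close> and of a quotient\<close>

lemma lie_ideal_quot_preimage:
  assumes "lie_ideal F (quot_lie L I) J"
  shows "lie_ideal F L {x \<in> carrier L. I +>\<^bsub>L\<^esub> x \<in> J}"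
proof -
  interpret Q: lie_algebra F "quot_lie L I" by (rule quot_lie_algebra)
  note sJ = Q.submoduleD[OF Q.lie_idealD(1)[OF assms]]
  note [simp] = quot_lie_simps(3-5)[symmetric]
  have "submodule {x \<in> carrier L. I +>\<^bsub>L\<^esub> x \<in> J} F L"
    using sJ(3,4,6) by (intro submoduleI') (auto simp: quot_lie_simps(2) coset_zero)
  moreover have "I +>\<^bsub>L\<^esub> x \<in> carrier (quot_lie L I)" if "x \<in> carrier L" for x
    using that by (simp add: quot_lie_simps(1))
  ultimately show ?thesis
    unfolding lie_ideal_def using Q.lie_idealD(3)[OF assms] by (auto simp: bracket_closed)
qed

lemma lie_ideal_quot_image:
  assumes "lie_ideal F L J"
  shows "lie_ideal F (quot_lie L I) ((\<lambda>x. I +>\<^bsub>L\<^esub> x) ` J)"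
proof -
  interpret Q: lie_algebra F "quot_lie L I" by (rule quot_lie_algebra)
  note sJ = submoduleD[OF lie_idealD(1)[OF assms]]
  have "submodule ((\<lambda>x. I +>\<^bsub>L\<^esub> x) ` J) F (quot_lie L I)"
  proof (rule Q.submoduleI')
    show "(\<lambda>x. I +>\<^bsub>L\<^esub> x) ` J \<subseteq> carrier (quot_lie L I)" using sJ(2) by (auto simp: quot_lie_simps)
    show "\<zero>\<^bsub>quot_lie L I\<^esub> \<in> (\<lambda>x. I +>\<^bsub>L\<^esub> x) ` J"
      using sJ(3) coset_zero by (auto simp: quot_lie_simps intro!: rev_image_eqI)
  qed (use sJ(2,4,6) in \<open>auto simp: quot_lie_simps\<close>)
  then show ?thesis
    unfolding lie_ideal_def using lie_idealD(3)[OF assms] sJ(2)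
    by (auto simp: quot_lie_simps)
qed

lemma quot_image_iff:
  assumes J: "submodule J F L" "I \<subseteq> J" and x: "x \<in> carrier L"
  shows "I +>\<^bsub>L\<^esub> x \<in> (\<lambda>x. I +>\<^bsub>L\<^esub> x) ` J \<longleftrightarrow> x \<in> J"
proof
  assume "I +>\<^bsub>L\<^esub> x \<in> (\<lambda>x. I +>\<^bsub>L\<^esub> x) ` J"
  then obtain y where y: "y \<in> J" "I +>\<^bsub>L\<^esub> x = I +>\<^bsub>L\<^esub> y" by auto
  then have "x \<in> I +>\<^bsub>L\<^esub> y" using coset_self[OF x] by simp
  then show "x \<in> J" using y(1) assms(2) submoduleD(4)[OF J(1)] unfolding coset_iff by auto
qed auto

lemma quot_preimage_image:
  assumes "J \<subseteq> carrier (quot_lie L I)"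
  shows "(\<lambda>x. I +>\<^bsub>L\<^esub> x) ` {x \<in> carrier L. I +>\<^bsub>L\<^esub> x \<in> J} = J"
  using assms by (auto simp: quot_lie_simps)

end

end

section \<open>Ascending chain condition\<close>

text \<open>A bounded, strictly increasing rank in place of a chain condition: maximal elements are
  then those of maximal rank, and subalgebras inherit the condition with the same \<open>d\<close>
  and \<open>b\<close>.\<close>

definition noetherian :: "('k, 'm) ring_scheme \<Rightarrow> ('k, 'a) module \<Rightarrow> bool" where
  "noetherian F L \<longleftrightarrow> (\<exists>(d :: 'a set \<Rightarrow> nat) b. \<forall>U. submodule U F L \<longrightarrow>
    d U \<le> b \<and> (\<forall>V. submodule V F L \<longrightarrow> U \<subset> V \<longrightarrow> d U < d V))"

context lie_algebra
begin

text \<open>\<open>d U\<close> counts the generators that occur as a leading term of an element of \<open>U\<close>.\<close>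

lemma span_leading_terms:
  assumes "finite B" "B \<subseteq> carrier L"
  shows "\<exists>(d :: 'a set \<Rightarrow> nat) W. submodule W F L \<and>
    (\<forall>c\<in>B \<rightarrow> carrier F. (\<Oplus>\<^bsub>L\<^esub>v\<in>B. c v \<odot>\<^bsub>L\<^esub> v) \<in> W) \<and>
    (\<forall>U. submodule U F L \<longrightarrow> d U \<le> card B) \<and>
    (\<forall>U V. submodule U F L \<longrightarrow> submodule V F L \<longrightarrow> U \<subseteq> V \<longrightarrow>
      d U \<le> d V \<and> (d U = d V \<longrightarrow> V \<inter> W \<subseteq> U))" (is "\<exists>d W. ?P B d W")
  using assms
proof (induction B)
  case empty
  show ?case
    by (rule exI[of _ "\<lambda>_. 0"], rule exI[of _ "{\<zero>\<^bsub>L\<^esub>}"]) (auto simp: submodule_zero dest: submoduleD(3))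
next
  case (insert b B)
  then obtain d :: "'a set \<Rightarrow> nat" and W where P: "?P B d W" by auto
  have W: "submodule W F L"
    and span: "\<And>c. c \<in> B \<rightarrow> carrier F \<Longrightarrow> (\<Oplus>\<^bsub>L\<^esub>v\<in>B. c v \<odot>\<^bsub>L\<^esub> v) \<in> W"
    and d: "\<And>U. submodule U F L \<Longrightarrow> d U \<le> card B"
      "\<And>U V. submodule U F L \<Longrightarrow> submodule V F L \<Longrightarrow> U \<subseteq> V \<Longrightarrow> d U \<le> d V"
      "\<And>U V. submodule U F L \<Longrightarrow> submodule V F L \<Longrightarrow> U \<subseteq> V \<Longrightarrow> d U = d V \<Longrightarrow> V \<inter> W \<subseteq> U"
    using P by simp_all
  have b: "b \<in> carrier L" using insert by auto
  define lead where "lead U \<longleftrightarrow> (\<exists>w\<in>W. b \<oplus>\<^bsub>L\<^esub> w \<in> U)" for U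
  define d' :: "'a set \<Rightarrow> nat" where "d' U = d U + (if lead U then 1 else 0)" for U
  define W' where "W' = {a \<odot>\<^bsub>L\<^esub> b \<oplus>\<^bsub>L\<^esub> w | a w. a \<in> carrier F \<and> w \<in> W}"
  note sW = submoduleD[OF W]
  have "submodule W' F L"
  proof (rule submoduleI')
    show "W' \<subseteq> carrier L" unfolding W'_def using b sW(2) by auto
    show "\<zero>\<^bsub>L\<^esub> \<in> W'"
      unfolding W'_def using b sW(3)
      by (intro CollectI exI[of _ \<zero>] exI[of _ "\<zero>\<^bsub>L\<^esub>"]) auto
  next
    fix x y assume "x \<in> W'" "y \<in> W'"
    then obtain p u q v where *: "p \<in> carrier F" "q \<in> carrier F" "u \<in> W" "v \<in> W"
      "x = p \<odot>\<^bsub>L\<^esub> b \<oplus>\<^bsub>L\<^esub> u" "y = q \<odot>\<^bsub>L\<^esub> b \<oplus>\<^bsub>L\<^esub> v" unfolding W'_def by blast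
    then have "x \<oplus>\<^bsub>L\<^esub> y = (p \<oplus> q) \<odot>\<^bsub>L\<^esub> b \<oplus>\<^bsub>L\<^esub> (u \<oplus>\<^bsub>L\<^esub> v)"
      using b sW(2) by (simp add: smult_l_distr M.a_ac)
    moreover have "p \<oplus> q \<in> carrier F" "u \<oplus>\<^bsub>L\<^esub> v \<in> W" using * sW(4) by auto
    ultimately show "x \<oplus>\<^bsub>L\<^esub> y \<in> W'" unfolding W'_def by blast
  next
    fix a x assume a: "a \<in> carrier F" and "x \<in> W'"
    then obtain p u where *: "p \<in> carrier F" "u \<in> W" "x = p \<odot>\<^bsub>L\<^esub> b \<oplus>\<^bsub>L\<^esub> u"
      unfolding W'_def by blast
    then have "a \<odot>\<^bsub>L\<^esub> x = (a \<otimes> p) \<odot>\<^bsub>L\<^esub> b \<oplus>\<^bsub>L\<^esub> a \<odot>\<^bsub>L\<^esub> u"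
      using a b sW(2) by (simp add: smult_r_distr smult_assoc1)
    moreover have "a \<otimes> p \<in> carrier F" "a \<odot>\<^bsub>L\<^esub> u \<in> W" using a * sW(6) by auto
    ultimately show "a \<odot>\<^bsub>L\<^esub> x \<in> W'" unfolding W'_def by blast
  qed
  moreover have "(\<Oplus>\<^bsub>L\<^esub>v\<in>insert b B. c v \<odot>\<^bsub>L\<^esub> v) \<in> W'" if c: "c \<in> insert b B \<rightarrow> carrier F" for c
  proof -
    have "(\<lambda>v. c v \<odot>\<^bsub>L\<^esub> v) \<in> B \<rightarrow> carrier L" "c b \<odot>\<^bsub>L\<^esub> b \<in> carrier L"
      using c insert.prems by auto
    then have "(\<Oplus>\<^bsub>L\<^esub>v\<in>insert b B. c v \<odot>\<^bsub>L\<^esub> v) = c b \<odot>\<^bsub>L\<^esub> b \<oplus>\<^bsub>L\<^esub> (\<Oplus>\<^bsub>L\<^esub>v\<in>B. c v \<odot>\<^bsub>L\<^esub> v)"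
      using insert.hyps by (intro M.finsum_insert) auto
    moreover have "c b \<in> carrier F" "(\<Oplus>\<^bsub>L\<^esub>v\<in>B. c v \<odot>\<^bsub>L\<^esub> v) \<in> W" using c span by auto
    ultimately show ?thesis unfolding W'_def by blast
  qed
  moreover have "d' U \<le> card (insert b B)" if "submodule U F L" for U
    using d(1)[OF that] insert.hyps by (simp add: d'_def)
  moreover have "d' U \<le> d' V \<and> (d' U = d' V \<longrightarrow> V \<inter> W' \<subseteq> U)"
    if U: "submodule U F L" and V: "submodule V F L" and UV: "U \<subseteq> V" for U V
  proof -
    have lead: "lead U \<Longrightarrow> lead V" unfolding lead_def using UV by blast
    note dUV = d(2,3)[OF U V UV]
    have "V \<inter> W' \<subseteq> U" if "d' U = d' V"
    proof
      fix x assume x: "x \<in> V \<inter> W'"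
      then obtain a w where aw: "a \<in> carrier F" "w \<in> W" "x = a \<odot>\<^bsub>L\<^esub> b \<oplus>\<^bsub>L\<^esub> w" unfolding W'_def by blast
      have eq: "d U = d V" "lead U = lead V"
        using that dUV(1) lead unfolding d'_def by (auto split: if_splits)
      have wc: "w \<in> carrier L" using aw sW(2) by simp
      show "x \<in> U"
      proof (cases "a = \<zero>")
        case True
        then have "x = w" using aw wc b by simp
        then show ?thesis using x aw dUV(2) eq by blast
      next
        \<comment> \<open>Scaling \<open>x\<close> shows that \<open>b\<close> is a leading term in
          \<open>V\<close>, hence also in \<open>U\<close>, where some \<open>b + u\<close> with
          \<open>u\<close> in \<open>W\<close> exists. Subtracting \<open>a\<close> times this
          element from \<open>x\<close> cancels the leading term. The rest \<open>z\<close> lies in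
          \<open>V\<close> and in \<open>W\<close>, so the induction hypothesis puts it into
          \<open>U\<close>.\<close>
        case False
        then have ia: "inv a \<in> carrier F" "inv a \<otimes> a = \<one>" "a \<otimes> inv a = \<one>"
          using aw field_Units by auto
        have "inv a \<odot>\<^bsub>L\<^esub> x = b \<oplus>\<^bsub>L\<^esub> inv a \<odot>\<^bsub>L\<^esub> w"
          using aw ia b wc by (simp add: smult_r_distr smult_assoc1[symmetric])
        moreover have "inv a \<odot>\<^bsub>L\<^esub> x \<in> V" using x ia submoduleD(6)[OF V] by blast
        ultimately have "lead V" unfolding lead_def using sW(6)[OF ia(1) aw(2)] by auto
        then obtain u where u: "u \<in> W" "b \<oplus>\<^bsub>L\<^esub> u \<in> U" using eq unfolding lead_def by blast
        have uc: "u \<in> carrier L" using u sW(2) by simp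
        define y where "y = a \<odot>\<^bsub>L\<^esub> (b \<oplus>\<^bsub>L\<^esub> u)"
        have yU: "y \<in> U" unfolding y_def using u aw submoduleD(6)[OF U] by blast
        have yc: "y \<in> carrier L" using yU submoduleD(2)[OF U] by simp
        have xc: "x \<in> carrier L" using x submoduleD(2)[OF V] by simp
        define z where "z = w \<oplus>\<^bsub>L\<^esub> \<ominus>\<^bsub>L\<^esub> (a \<odot>\<^bsub>L\<^esub> u)"
        have zW: "z \<in> W" unfolding z_def by (rule sW(4)[OF aw(2) sW(5)[OF sW(6)[OF aw(1) u(1)]]])
        have zc: "z \<in> carrier L" using zW sW(2) by simp
        have yz: "y = a \<odot>\<^bsub>L\<^esub> b \<oplus>\<^bsub>L\<^esub> a \<odot>\<^bsub>L\<^esub> u" unfolding y_def using aw b uc by (simp add: smult_r_distr)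
        have "y \<oplus>\<^bsub>L\<^esub> z = a \<odot>\<^bsub>L\<^esub> b \<oplus>\<^bsub>L\<^esub> (w \<oplus>\<^bsub>L\<^esub> (a \<odot>\<^bsub>L\<^esub> u \<oplus>\<^bsub>L\<^esub> \<ominus>\<^bsub>L\<^esub> (a \<odot>\<^bsub>L\<^esub> u)))"
          unfolding yz z_def using aw b uc wc by (simp add: M.a_ac)
        also have "\<dots> = x" using aw b uc wc by (simp add: M.r_neg)
        finally have xyz: "x = y \<oplus>\<^bsub>L\<^esub> z" by simp
        then have "z = \<ominus>\<^bsub>L\<^esub> y \<oplus>\<^bsub>L\<^esub> x" using yc zc by (simp add: M.r_neg1)
        then have "z \<in> V"
          using x yU UV submoduleD(4)[OF V submoduleD(5)[OF V, of y], of x] by auto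
        then have "z \<in> U" using zW dUV(2) eq by blast
        then show ?thesis unfolding xyz using yU submoduleD(4)[OF U] by simp
      qed
    qed
    moreover have "d' U \<le> d' V" using dUV(1) lead by (simp add: d'_def)
    ultimately show ?thesis by blast
  qed
  ultimately show ?case by (intro exI[of _ d'] exI[of _ W']) blast
qed

lemma finite_dimensional_noetherian:
  assumes "finite_dimensional F L"
  shows "noetherian F L"
proof -
  obtain B where B: "finite B" "B \<subseteq> carrier L"
    "\<And>x. x \<in> carrier L \<Longrightarrow> \<exists>c\<in>B \<rightarrow> carrier F. x = (\<Oplus>\<^bsub>L\<^esub>v\<in>B. c v \<odot>\<^bsub>L\<^esub> v)"
    using assms unfolding finite_dimensional_def by blast
  obtain d :: "'a set \<Rightarrow> nat" and W where P: "submodule W F L \<and>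
    (\<forall>c\<in>B \<rightarrow> carrier F. (\<Oplus>\<^bsub>L\<^esub>v\<in>B. c v \<odot>\<^bsub>L\<^esub> v) \<in> W) \<and>
    (\<forall>U. submodule U F L \<longrightarrow> d U \<le> card B) \<and>
    (\<forall>U V. submodule U F L \<longrightarrow> submodule V F L \<longrightarrow> U \<subseteq> V \<longrightarrow>
      d U \<le> d V \<and> (d U = d V \<longrightarrow> V \<inter> W \<subseteq> U))"
    using span_leading_terms[OF B(1,2)] by (elim exE) blast
  have W: "submodule W F L"
    and span: "\<forall>c\<in>B \<rightarrow> carrier F. (\<Oplus>\<^bsub>L\<^esub>v\<in>B. c v \<odot>\<^bsub>L\<^esub> v) \<in> W"
    and d: "\<And>U. submodule U F L \<Longrightarrow> d U \<le> card B"
      "\<And>U V. submodule U F L \<Longrightarrow> submodule V F L \<Longrightarrow> U \<subseteq> V \<Longrightarrow>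
        d U \<le> d V \<and> (d U = d V \<longrightarrow> V \<inter> W \<subseteq> U)"
    using P by simp_all
  have "carrier L \<subseteq> W" using B(3) span by fastforce
  have "d U < d V" if "submodule U F L" "submodule V F L" "U \<subset> V" for U V
  proof -
    have "\<not> V \<inter> W \<subseteq> U" using that submoduleD(1)[OF that(2)] \<open>carrier L \<subseteq> W\<close> by blast
    then show ?thesis using d(2)[OF that(1,2)] that(3) by fastforce
  qed
  then show ?thesis unfolding noetherian_def using d(1) by blast
qed

lemma noetherian_sub_lie:
  assumes "noetherian F L" "submodule U F L"
  shows "noetherian F (sub_lie L U)"
proof -
  obtain d :: "'a set \<Rightarrow> nat" and b where "\<forall>U. submodule U F L \<longrightarrow>
      d U \<le> b \<and> (\<forall>V. submodule V F L \<longrightarrow> U \<subset> V \<longrightarrow> d U < d V)"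
    using assms(1) unfolding noetherian_def by (elim exE)
  then show ?thesis
    unfolding noetherian_def submodule_sub_lie_iff[OF assms(2)]
    by (intro exI[of _ d] exI[of _ b]) simp
qed

text \<open>A member of maximal rank absorbs every other member, since their sum is again a member.
  This provides the greatest elements required by \<open>GREATEST\<close> in the nilradical and the
  core.\<close>

lemma noetherian_greatest:
  assumes "noetherian F L"
    and "P U0" and sub: "\<And>U. P U \<Longrightarrow> submodule U F L"
    and join: "\<And>U V. P U \<Longrightarrow> P V \<Longrightarrow> P (U <+>\<^bsub>L\<^esub> V)"
  obtains W where "P W" "\<And>U. P U \<Longrightarrow> U \<subseteq> W"
proof -
  obtain d :: "'a set \<Rightarrow> nat" and b where d: "\<And>U. submodule U F L \<Longrightarrow> d U \<le> b"
    "\<And>U V. submodule U F L \<Longrightarrow> submodule V F L \<Longrightarrow> U \<subset> V \<Longrightarrow> d U < d V"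
    using assms(1) unfolding noetherian_def by blast
  define W where "W = arg_max d P"
  have "\<forall>U. P U \<longrightarrow> d U < Suc b" using d(1) sub by (simp add: less_Suc_eq_le)
  then have W: "P W" "\<And>U. P U \<Longrightarrow> d U \<le> d W"
    unfolding W_def using arg_max_nat_lemma[of P U0 d "Suc b"] assms(2) by auto
  have "U \<subseteq> W" if "P U" for U
  proof -
    have "W \<subseteq> U <+>\<^bsub>L\<^esub> W" "U \<subseteq> U <+>\<^bsub>L\<^esub> W" using set_add_upper sub that W(1) by auto
    moreover have "\<not> W \<subset> U <+>\<^bsub>L\<^esub> W"
      using d(2)[of W "U <+>\<^bsub>L\<^esub> W"] W(2)[of "U <+>\<^bsub>L\<^esub> W"] join sub that W(1) by fastforce
    ultimately show ?thesis by blast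
  qed
  then show ?thesis using that W(1) by blast
qed

end

section \<open>Nilpotency modulo an ideal\<close>

context lie_algebra
begin

text \<open>A word of \<open>k\<close> letters either has all of them in \<open>B\<close> or
  contains one from \<open>N\<close>. In both cases it moves one step down the filtration, as the
  remaining letters preserve ideals.\<close>

lemma drives_Un_filtration:
  assumes V: "\<And>m. lie_ideal F L (V m)"
    and N: "N \<subseteq> carrier L" "\<And>m a v. a \<in> N \<Longrightarrow> v \<in> V m \<Longrightarrow> a \<otimes>\<^bsub>L\<^esub> v \<in> V (Suc m)"
    and B: "B \<subseteq> carrier L" "\<And>m xs v. set xs \<subseteq> B \<Longrightarrow> length xs = k \<Longrightarrow> v \<in> V m \<Longrightarrow> bracket_word L xs v \<in> V (Suc m)"
  shows "drives L (B \<union> N) (V 0) (V c)"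
proof (induction c)
  case 0
  show ?case by (rule drivesI[of _ 0]) auto
next
  case (Suc c)
  have "bracket_word L xs v \<in> V (Suc c)"
    if xs: "set xs \<subseteq> B \<union> N" "length xs = k" and v: "v \<in> V c" for xs v
  proof (cases "set xs \<subseteq> B")
    case True
    then show ?thesis using B xs v by blast
  next
    case False
    then obtain x where x: "x \<in> set xs" "x \<in> N" using xs by blast
    then obtain ys zs where yz: "xs = ys @ x # zs" using split_list by metis
    have c: "set ys \<subseteq> carrier L" "set zs \<subseteq> carrier L" using xs yz B(1) N(1) by auto
    have "x \<otimes>\<^bsub>L\<^esub> bracket_word L zs v \<in> V (Suc c)"
      using x(2) N(2) bracket_word_ideal[OF V c(2) v] by blast
    then show ?thesis unfolding yz using bracket_word_ideal[OF V c(1)] by simp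
  qed
  then have "drives L (B \<union> N) (V c) (V (Suc c))" by (rule drivesI)
  then show ?case using Suc drives_trans by blast
qed

text \<open>Up to \<open>Z\<close>, term \<open>m\<close> is spanned by the products of
  \<open>m\<close> operators ad a with a in \<open>N\<close>, applied to all of \<open>L\<close>.
  Starting from \<open>L\<close> instead of \<open>N\<close> yields a filtration of \<open>L\<close>
  itself, on which elements and derivations outside \<open>N\<close> can be followed.\<close>

primrec power_mod :: "'a set \<Rightarrow> 'a set \<Rightarrow> nat \<Rightarrow> 'a set" where
  "power_mod N Z 0 = carrier L"
| "power_mod N Z (Suc m) = lie_product F L N (power_mod N Z m) <+>\<^bsub>L\<^esub> Z"

context
  fixes N Z
  assumes N: "lie_ideal F L N" and Z: "lie_ideal F L Z"
begin

lemma power_mod_ideal: "lie_ideal F L (power_mod N Z m)"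
  by (induction m) (use N Z in \<open>auto intro: lie_ideal_carrier lie_ideal_set_add lie_ideal_product\<close>)

lemma power_mod_mult: "a \<in> N \<Longrightarrow> v \<in> power_mod N Z m \<Longrightarrow> a \<otimes>\<^bsub>L\<^esub> v \<in> power_mod N Z (Suc m)"
  using set_add_upper(1)[OF lie_idealD(1)[OF lie_ideal_product[OF N power_mod_ideal]] lie_idealD(1)[OF Z]]
    lie_product_mem[of a N v] by auto

lemma power_mod_lower: "Z \<subseteq> power_mod N Z m"
  using set_add_upper(2)[OF lie_idealD(1)[OF lie_ideal_product[OF N power_mod_ideal]] lie_idealD(1)[OF Z]]
    lie_idealD(2)[OF Z] by (cases m) auto

lemma power_mod_least:
  assumes "submodule V F L" "Z \<subseteq> V" "\<And>a v. a \<in> N \<Longrightarrow> v \<in> power_mod N Z m \<Longrightarrow> a \<otimes>\<^bsub>L\<^esub> v \<in> V"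
  shows "power_mod N Z (Suc m) \<subseteq> V"
  unfolding power_mod.simps using assms by (intro set_add_least lie_product_least) auto

lemma power_mod_decseq: "m \<le> n \<Longrightarrow> power_mod N Z n \<subseteq> power_mod N Z m"
proof (induction n rule: dec_induct)
  case (step n)
  have "power_mod N Z (Suc n) \<subseteq> power_mod N Z n"
    using power_mod_lower lie_idealD(1,3)[OF power_mod_ideal] lie_idealD(2)[OF N]
    by (intro power_mod_least) auto
  then show ?case using step by blast
qed auto

lemma power_mod_subset:
  assumes n: "\<And>xs v. set xs \<subseteq> N \<Longrightarrow> length xs = n \<Longrightarrow> v \<in> carrier L \<Longrightarrow> bracket_word L xs v \<in> Z"
  shows "power_mod N Z n \<subseteq> Z"
proof -
  define W where "W k = {xs. set xs \<subseteq> N \<and> length xs = k}" for k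
  have "power_mod N Z i \<subseteq> {v \<in> carrier L. \<forall>xs\<in>W (n - i). bracket_word L xs v \<in> Z}"
    if "i \<le> n" for i
    using that
  proof (induction i)
    case 0 then show ?case using n by (auto simp: W_def)
  next
    case (Suc i)
    show ?case
    proof (rule power_mod_least)
      show "submodule {v \<in> carrier L. \<forall>xs\<in>W (n - Suc i). bracket_word L xs v \<in> Z} F L"
        using lie_idealD(1)[OF Z] lie_idealD(2)[OF N] by (intro submodule_word_preimage) (auto simp: W_def)
      show "Z \<subseteq> {v \<in> carrier L. \<forall>xs\<in>W (n - Suc i). bracket_word L xs v \<in> Z}"
        using bracket_word_ideal[OF Z] lie_idealD(2)[OF N] lie_idealD(2)[OF Z] by (auto simp: W_def)
      fix a v assume a: "a \<in> N" and v: "v \<in> power_mod N Z i"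
      have "bracket_word L xs (a \<otimes>\<^bsub>L\<^esub> v) \<in> Z" if "xs \<in> W (n - Suc i)" for xs
      proof -
        have "xs @ [a] \<in> W (n - i)" using that a Suc.prems by (auto simp: W_def)
        then have "bracket_word L (xs @ [a]) v \<in> Z" using Suc v by (blast dest: Suc_leD)
        then show ?thesis by simp
      qed
      moreover have "a \<otimes>\<^bsub>L\<^esub> v \<in> carrier L"
        using a v lie_idealD(2)[OF N] lie_idealD(2)[OF power_mod_ideal] bracket_closed by blast
      ultimately show "a \<otimes>\<^bsub>L\<^esub> v \<in> {v \<in> carrier L. \<forall>xs\<in>W (n - Suc i). bracket_word L xs v \<in> Z}"
        by blast
    qed
  qed
  from this[of n] show ?thesis by (auto simp: W_def)
qed

lemma ideal_drives_carrier:
  assumes "drives L N N Z"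
  shows "drives L N (carrier L) Z"
  using drives_trans[OF drives_step assms] lie_idealD(4)[OF N] by blast

text \<open>Long words in \<open>B\<close> end in \<open>Z\<close>, which lies in every term of
  \<open>power_mod\<close>, so they move each term into the next one, as single letters from
  \<open>N\<close> do. Multilinearity then passes from the union to the sum. The set
  \<open>B\<close> need not be an ideal, which matters for ideals of \<open>M\<close>.\<close>

lemma drives_ideal_add:
  assumes B: "B \<subseteq> carrier L" "drives L B (carrier L) Z" and dr: "drives L N N Z"
  shows "drives L (B <+>\<^bsub>L\<^esub> N) (carrier L) Z"
proof -
  obtain k where k: "\<And>xs v. set xs \<subseteq> B \<Longrightarrow> length xs = k \<Longrightarrow> v \<in> carrier L \<Longrightarrow> bracket_word L xs v \<in> Z"
    using B(2) unfolding drives_def by metis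
  obtain c where c: "power_mod N Z c \<subseteq> Z"
    using ideal_drives_carrier[OF dr] power_mod_subset unfolding drives_def by metis
  have "drives L (B \<union> N) (power_mod N Z 0) (power_mod N Z c)"
  proof (rule drives_Un_filtration[where k = k])
    fix m xs v assume "set xs \<subseteq> B" "length xs = k" "v \<in> power_mod N Z m"
    then show "bracket_word L xs v \<in> power_mod N Z (Suc m)"
      using k lie_idealD(2)[OF power_mod_ideal] power_mod_lower by blast
  qed (use power_mod_ideal power_mod_mult B lie_idealD(2)[OF N] in auto)
  then have "drives L (B \<union> N) (carrier L) Z" using c by (auto elim: drives_mono)
  then show ?thesis
    using B lie_idealD(2)[OF N] lie_idealD(1)[OF Z] by (intro drives_set_add) auto
qed

end

declare power_mod.simps(2) [simp del]

end

section \<open>The upper nilpotent series\<close>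

context lie_algebra
begin

text \<open>Fitting's theorem modulo \<open>Z\<close>. Nilpotency of \<open>I\<close> is first
  extended to its action on \<open>L\<close>, since one bracket already carries \<open>L\<close>
  into \<open>I\<close>.\<close>

lemma nil_ideal_add:
  assumes "lie_ideal F L I" "lie_ideal F L J" "lie_ideal F L Z" "drives L I I Z" "drives L J J Z"
  shows "drives L (I <+>\<^bsub>L\<^esub> J) (I <+>\<^bsub>L\<^esub> J) Z"
proof -
  have "drives L (I <+>\<^bsub>L\<^esub> J) (carrier L) Z"
    using assms lie_idealD(2)[OF assms(1)] ideal_drives_carrier[OF assms(1,3,4)]
    by (intro drives_ideal_add)
  then show ?thesis
    using lie_idealD(2)[OF lie_ideal_set_add[OF assms(1,2)]] by (auto elim: drives_mono)
qed

lemma lie_nilpotent_quot_iff: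
  assumes I: "lie_ideal F L I" and J: "lie_ideal F L J"
  shows "lie_nilpotent F (sub_lie (quot_lie L I) ((\<lambda>x. I +>\<^bsub>L\<^esub> x) ` J)) \<longleftrightarrow> drives L J J I"
proof -
  interpret Q: lie_algebra F "quot_lie L I" by (rule quot_lie_algebra[OF I])
  have "lie_subalgebra F (quot_lie L I) ((\<lambda>x. I +>\<^bsub>L\<^esub> x) ` J)"
    using lie_ideal_quot_image[OF I J] Q.lie_ideal_is_subalgebra by blast
  from lower_central_quot_eq_zero_iff[OF I lie_idealD(2)[OF J] this]
  show ?thesis
    unfolding lie_nilpotent_def drives_def sub_lie_simps quot_lie_simps(2)[OF I] by (intro ex_cong1)
qed

text \<open>The one place where the \<open>GREATEST\<close> in the nilradical is evaluated;
  afterwards only ideals of \<open>L\<close> and words occur.\<close>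

lemma nilradical_quot:
  assumes "noetherian F L" and I: "lie_ideal F L I"
  obtains W where "{x \<in> carrier L. I +>\<^bsub>L\<^esub> x \<in> nilradical F (quot_lie L I)} = W"
    "lie_ideal F L W" "I \<subseteq> W" "drives L W W I"
    "\<And>J. lie_ideal F L J \<Longrightarrow> drives L J J I \<Longrightarrow> J \<subseteq> W"
proof -
  let ?p = "\<lambda>x. I +>\<^bsub>L\<^esub> x"
  define P where "P U \<longleftrightarrow> lie_ideal F L U \<and> drives L U U I" for U
  have PI: "P I" unfolding P_def using I drivesI[of I 0 I L I] by simp
  have Psub: "submodule U F L" if "P U" for U using that lie_idealD(1) unfolding P_def by blast
  have Padd: "P (U <+>\<^bsub>L\<^esub> V)" if "P U" "P V" for U V
    using that I lie_ideal_set_add nil_ideal_add unfolding P_def by blast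
  obtain W where W: "P W" "\<And>U. P U \<Longrightarrow> U \<subseteq> W"
    using noetherian_greatest[OF assms(1), of P, OF PI Psub Padd] by blast
  have W': "lie_ideal F L W" "drives L W W I" using W(1) unfolding P_def by auto
  have IW: "I \<subseteq> W" using W(2) PI by blast
  interpret Q: lie_algebra F "quot_lie L I" by (rule quot_lie_algebra[OF I])
  have "nilradical F (quot_lie L I) = ?p ` W"
    unfolding nilradical_def
  proof (rule Greatest_equality)
    show "lie_ideal F (quot_lie L I) (?p ` W) \<and> lie_nilpotent F (sub_lie (quot_lie L I) (?p ` W))"
      using W' lie_ideal_quot_image[OF I] lie_nilpotent_quot_iff[OF I] by blast
  next
    fix J assume J: "lie_ideal F (quot_lie L I) J \<and> lie_nilpotent F (sub_lie (quot_lie L I) J)"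
    let ?J = "{x \<in> carrier L. ?p x \<in> J}"
    have iJ: "lie_ideal F L ?J" using lie_ideal_quot_preimage[OF I] J by blast
    have eq: "?p ` ?J = J" using quot_preimage_image[OF I] Q.lie_idealD(2) J by blast
    have "drives L ?J ?J I" using lie_nilpotent_quot_iff[OF I iJ] J unfolding eq by blast
    then have "?J \<subseteq> W" using W(2) iJ unfolding P_def by blast
    then show "J \<le> ?p ` W" using eq by blast
  qed
  then have "{x \<in> carrier L. ?p x \<in> nilradical F (quot_lie L I)} = W"
    using quot_image_iff[OF I lie_idealD(1)[OF W'(1)] IW] lie_idealD(2)[OF W'(1)] by auto
  then show ?thesis using that W' IW W(2) unfolding P_def by blast
qed

section \<open>Centralizers of factors\<close>

lemma bracket_bracket:
  assumes "x \<in> carrier L" "y \<in> carrier L" "z \<in> carrier L"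
  shows "(x \<otimes>\<^bsub>L\<^esub> y) \<otimes>\<^bsub>L\<^esub> z = x \<otimes>\<^bsub>L\<^esub> (y \<otimes>\<^bsub>L\<^esub> z) \<oplus>\<^bsub>L\<^esub> \<ominus>\<^bsub>L\<^esub> (y \<otimes>\<^bsub>L\<^esub> (x \<otimes>\<^bsub>L\<^esub> z))"
  unfolding bracket_leibniz[OF assms] using assms bracket_closed by (simp add: M.a_assoc M.r_neg)

lemma submodule_diff:
  "submodule U F L \<Longrightarrow> x \<in> U \<Longrightarrow> y \<in> U \<Longrightarrow> x \<oplus>\<^bsub>L\<^esub> \<ominus>\<^bsub>L\<^esub> y \<in> U"
  using submoduleD(4,5) by blast

lemma lie_ideal_centralizer:
  assumes N: "lie_ideal F L N" and Z: "lie_ideal F L Z"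
  shows "lie_ideal F L {x \<in> carrier L. \<forall>y\<in>N. x \<otimes>\<^bsub>L\<^esub> y \<in> Z}"
  unfolding lie_ideal_def
proof (intro conjI ballI)
  note sZ = submoduleD[OF lie_idealD(1)[OF Z]]
  have Nc: "y \<in> carrier L" if "y \<in> N" for y using that lie_idealD(2)[OF N] by blast
  show "submodule {x \<in> carrier L. \<forall>y\<in>N. x \<otimes>\<^bsub>L\<^esub> y \<in> Z} F L"
    by (rule submoduleI') (use Nc sZ(3,4,6) in \<open>auto simp: bracket_add_left bracket_smult_left\<close>)
  fix x c assume x: "x \<in> carrier L" and c: "c \<in> {x \<in> carrier L. \<forall>y\<in>N. x \<otimes>\<^bsub>L\<^esub> y \<in> Z}"
  have "(x \<otimes>\<^bsub>L\<^esub> c) \<otimes>\<^bsub>L\<^esub> y \<in> Z" if y: "y \<in> N" for y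
  proof -
    have "x \<otimes>\<^bsub>L\<^esub> (c \<otimes>\<^bsub>L\<^esub> y) \<in> Z" using c y x lie_idealD(3)[OF Z] by blast
    moreover have "c \<otimes>\<^bsub>L\<^esub> (x \<otimes>\<^bsub>L\<^esub> y) \<in> Z" using c y x lie_idealD(3)[OF N] by blast
    moreover have "(x \<otimes>\<^bsub>L\<^esub> c) \<otimes>\<^bsub>L\<^esub> y = x \<otimes>\<^bsub>L\<^esub> (c \<otimes>\<^bsub>L\<^esub> y) \<oplus>\<^bsub>L\<^esub> \<ominus>\<^bsub>L\<^esub> (c \<otimes>\<^bsub>L\<^esub> (x \<otimes>\<^bsub>L\<^esub> y))"
      using x c Nc[OF y] by (intro bracket_bracket) auto
    ultimately show ?thesis using submodule_diff[OF lie_idealD(1)[OF Z]] by simp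
  qed
  then show "x \<otimes>\<^bsub>L\<^esub> c \<in> {x \<in> carrier L. \<forall>y\<in>N. x \<otimes>\<^bsub>L\<^esub> y \<in> Z}"
    using x c bracket_closed by blast
qed

text \<open>If \<open>b\<^sub>1 \<cdots> b\<^sub>n\<close> acts as zero on \<open>N/Z\<close>, then the commutator of \<open>2n\<close> operators \<open>ad b\<close> with \<open>ad y\<close>
  vanishes there, since each of its terms has \<open>n\<close> consecutive factors on one side of \<open>ad y\<close>.\<close>

lemma drives_centralizer:
  assumes N: "lie_ideal F L N" and Z: "lie_ideal F L Z" and ZN: "Z \<subseteq> N"
    and B: "B \<subseteq> carrier L" and dr: "drives L B N Z"
  shows "drives L B (carrier L) {x \<in> carrier L. \<forall>y\<in>N. x \<otimes>\<^bsub>L\<^esub> y \<in> Z}"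
proof -
  obtain n where n: "\<And>xs v. set xs \<subseteq> B \<Longrightarrow> length xs = n \<Longrightarrow> v \<in> N \<Longrightarrow> bracket_word L xs v \<in> Z"
    using dr unfolding drives_def by metis
  define T where "T j = {u \<in> N. \<forall>xs. set xs \<subseteq> B \<longrightarrow> length xs = j \<longrightarrow> bracket_word L xs u \<in> Z}" for j
  have "T j = N \<inter> {v \<in> carrier L. \<forall>xs\<in>{xs. set xs \<subseteq> B \<and> length xs = j}. bracket_word L xs v \<in> Z}" for j
    unfolding T_def using lie_idealD(2)[OF N] by auto
  moreover have "submodule {v \<in> carrier L. \<forall>xs\<in>{xs. set xs \<subseteq> B \<and> length xs = j}.
      bracket_word L xs v \<in> Z} F L" for j
    using B by (intro submodule_word_preimage lie_idealD(1)[OF Z]) auto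
  ultimately have Tsub: "submodule (T j) F L" for j
    using submodule_Int[OF lie_idealD(1)[OF N]] by simp
  have Tn: "T n = N" unfolding T_def using n by blast
  have T0: "T 0 = Z" unfolding T_def using ZN by auto
  have ZT: "Z \<subseteq> T j" for j unfolding T_def using ZN B bracket_word_ideal[OF Z] by blast
  have TN: "T j \<subseteq> N" for j unfolding T_def by blast
  have step: "b \<otimes>\<^bsub>L\<^esub> u \<in> T j" if "b \<in> B" "u \<in> T (Suc j)" for b u j
  proof -
    have "bracket_word L xs (b \<otimes>\<^bsub>L\<^esub> u) \<in> Z" if "set xs \<subseteq> B" "length xs = j" for xs
    proof -
      have "bracket_word L (xs @ [b]) u \<in> Z"
        using that \<open>b \<in> B\<close> \<open>u \<in> T (Suc j)\<close> unfolding T_def by (auto simp del: bracket_word_simps)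
      then show ?thesis by simp
    qed
    then show ?thesis using that B lie_idealD(3)[OF N] unfolding T_def by blast
  qed
  \<comment> \<open>By [[b, f], u] = [b, [f, u]] - [f, [b, u]] a letter either stays outside, where
    \<open>T (Suc j)\<close> suffices instead of \<open>T j\<close>, or moves onto \<open>u\<close>
    and lowers \<open>i\<close>. Both preserve the inequality. The claim is clear for
    \<open>i = 0\<close>, where \<open>u\<close> is in \<open>Z\<close>, and for
    \<open>j = n\<close>, where \<open>T n\<close> is \<open>N\<close>. Taking \<open>i = n\<close>
    and \<open>j = 0\<close> requires the length \<open>2 * n\<close>.\<close>
  have *: "bracket_word L xs y \<otimes>\<^bsub>L\<^esub> u \<in> T j"
    if "set xs \<subseteq> B" "i + n \<le> length xs + j" "i \<le> n" "j \<le> n" "y \<in> carrier L" "u \<in> T i" for xs i j y u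
    using that
  proof (induction xs arbitrary: i j u)
    case Nil
    then have "j = n" by simp
    then show ?case using Nil Tn TN lie_idealD(3)[OF N] by (simp add: subset_iff)
  next
    case (Cons b xs)
    let ?f = "bracket_word L xs y"
    have bc: "b \<in> carrier L" "set xs \<subseteq> carrier L" using Cons.prems B by auto
    then have fc: "?f \<in> carrier L" "b \<otimes>\<^bsub>L\<^esub> ?f \<in> carrier L"
      using Cons.prems bracket_word_closed bracket_closed by auto
    have uN: "u \<in> N" "u \<in> carrier L" using Cons.prems TN lie_idealD(2)[OF N] by auto
    consider "i = 0" | "j = n" | i' where "i = Suc i'" "j < n"
      using le_neq_implies_less[OF Cons.prems(4)] by (cases i) auto
    then show ?case
    proof cases
      case 1
      then have "u \<in> Z" using Cons.prems T0 by simp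
      then show ?thesis using lie_idealD(3)[OF Z fc(2)] ZT by auto
    next
      case 2
      then show ?thesis using lie_idealD(3)[OF N fc(2) uN(1)] Tn by simp
    next
      case 3
      have "?f \<otimes>\<^bsub>L\<^esub> u \<in> T (Suc j)" using Cons.prems 3 by (intro Cons.IH[of i]) auto
      then have "b \<otimes>\<^bsub>L\<^esub> (?f \<otimes>\<^bsub>L\<^esub> u) \<in> T j" using step Cons.prems by simp
      moreover have "b \<otimes>\<^bsub>L\<^esub> u \<in> T i'" using step Cons.prems 3 by simp
      then have "?f \<otimes>\<^bsub>L\<^esub> (b \<otimes>\<^bsub>L\<^esub> u) \<in> T j" using Cons.prems 3 by (intro Cons.IH[of i']) auto
      ultimately show ?thesis
        using submodule_diff[OF Tsub] bracket_bracket[OF bc(1) fc(1) uN(2)] by simp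
    qed
  qed
  show ?thesis
  proof (rule drivesI)
    fix xs v assume xs: "set xs \<subseteq> B" "length xs = 2 * n" and v: "v \<in> carrier L"
    have "bracket_word L xs v \<otimes>\<^bsub>L\<^esub> u \<in> Z" if "u \<in> N" for u
      using *[OF xs(1), of n 0 v u] xs(2) v that Tn T0 by simp
    then show "bracket_word L xs v \<in> {x \<in> carrier L. \<forall>y\<in>N. x \<otimes>\<^bsub>L\<^esub> y \<in> Z}"
      using xs B v bracket_word_closed[of xs v] by auto
  qed
qed

lemma derived_series_ideal: "lie_ideal F L (derived_series F L i)"
  by (induction i) (auto intro: lie_ideal_carrier lie_ideal_product)

end

text \<open>Finite dimension is used only through this condition. As subalgebras inherit it, the
  lemmas below apply to \<open>M\<close> and its core as well as to \<open>L\<close>.\<close>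

locale noetherian_lie_algebra = lie_algebra +
  assumes noetherian: "noetherian F L"
begin

lemma sub_lie_noetherian_lie_algebra:
  assumes "lie_subalgebra F L U"
  shows "noetherian_lie_algebra F (sub_lie L U)"
proof -
  interpret S: lie_algebra F "sub_lie L U" by (rule sub_lie_algebra[OF assms])
  show ?thesis
    using noetherian_sub_lie[OF noetherian] assms unfolding lie_subalgebra_def
    by unfold_locales blast
qed

lemma upper_nilpotent_ideal: "lie_ideal F L (upper_nilpotent F L i)"
proof (induction i)
  case 0 then show ?case using lie_ideal_zero by simp
next
  case (Suc i)
  show ?case by (rule nilradical_quot[OF noetherian Suc]) simp
qed

lemma upper_nilpotent_Suc:
  "upper_nilpotent F L i \<subseteq> upper_nilpotent F L (Suc i)"
  "drives L (upper_nilpotent F L (Suc i)) (upper_nilpotent F L (Suc i)) (upper_nilpotent F L i)"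
  "lie_ideal F L J \<Longrightarrow> drives L J J (upper_nilpotent F L i) \<Longrightarrow> J \<subseteq> upper_nilpotent F L (Suc i)"
  by (rule nilradical_quot[OF noetherian upper_nilpotent_ideal[of i]]; simp)+

declare upper_nilpotent.simps(2) [simp del]

lemma upper_nilpotent_carrier: "upper_nilpotent F L i \<subseteq> carrier L"
  using lie_idealD(2)[OF upper_nilpotent_ideal] .

lemma upper_nilpotent_mono: "i \<le> j \<Longrightarrow> upper_nilpotent F L i \<subseteq> upper_nilpotent F L j"
  using upper_nilpotent_Suc(1) by (rule lift_Suc_mono_le)

text \<open>Modulo \<open>N_k\<close> this is the fact that the nilradical of a solvable algebra
  contains its centralizer. Let \<open>C\<close> be the centralizer of the factor and climb the
  derived series from its zero term. If \<open>C\<close> meets the next derived term inside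
  \<open>N\<close>, then brackets of two elements of \<open>C \<inter> D j\<close> are in
  \<open>N\<close>, and a third letter from \<open>C\<close> sends them into \<open>Z\<close>. So
  this ideal is nilpotent modulo \<open>Z\<close> and lies in \<open>N\<close>.\<close>

lemma upper_nilpotent_centralizer:
  assumes "lie_solvable F L" and x: "x \<in> carrier L"
    and xN: "\<And>y. y \<in> upper_nilpotent F L (Suc k) \<Longrightarrow> x \<otimes>\<^bsub>L\<^esub> y \<in> upper_nilpotent F L k"
  shows "x \<in> upper_nilpotent F L (Suc k)"
proof -
  define N Z where "N = upper_nilpotent F L (Suc k)" and "Z = upper_nilpotent F L k"
  define C where "C = {x \<in> carrier L. \<forall>y\<in>N. x \<otimes>\<^bsub>L\<^esub> y \<in> Z}"
  define D where "D = derived_series F L"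
  have C: "lie_ideal F L C"
    unfolding C_def N_def Z_def using lie_ideal_centralizer upper_nilpotent_ideal by blast
  have D: "lie_ideal F L (D i)" for i unfolding D_def by (rule derived_series_ideal)
  obtain m where m: "D m = {\<zero>\<^bsub>L\<^esub>}" using assms(1) unfolding lie_solvable_def D_def by blast
  have "C \<inter> D (m - i) \<subseteq> N" if "i \<le> m" for i
    using that
  proof (induction i)
    case 0
    then show ?case using m submoduleD(3)[OF lie_idealD(1)[OF upper_nilpotent_ideal]] N_def by auto
  next
    case (Suc i)
    define j where "j = m - Suc i"
    then have mi: "m - i = Suc j" using Suc.prems by simp
    have IH: "C \<inter> D (Suc j) \<subseteq> N" using Suc unfolding mi by simp
    have "drives L (C \<inter> D j) (C \<inter> D j) Z"
    proof (rule drivesI)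
      fix xs v assume "set xs \<subseteq> C \<inter> D j" "length xs = 2" and v: "v \<in> C \<inter> D j"
      then obtain a b where xs: "xs = [a, b]" "a \<in> C" "b \<in> C" "b \<in> D j"
        by (auto simp: numeral_2_eq_2 length_Suc_conv)
      have "b \<otimes>\<^bsub>L\<^esub> v \<in> D (Suc j)" unfolding D_def
        using lie_product_mem xs(4) v by (simp add: D_def)
      moreover have "b \<otimes>\<^bsub>L\<^esub> v \<in> C" using v xs(3) lie_idealD(3)[OF C] lie_idealD(2)[OF C] by blast
      ultimately have "b \<otimes>\<^bsub>L\<^esub> v \<in> N" using IH by blast
      then show "bracket_word L xs v \<in> Z" using xs unfolding C_def by simp
    qed
    then show ?case
      using upper_nilpotent_Suc(3)[OF lie_ideal_Int[OF C D]] unfolding N_def Z_def j_def by blast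
  qed
  from this[of m] have "C \<subseteq> N" using lie_idealD(2)[OF C] by (auto simp: D_def)
  moreover have "x \<in> C" unfolding C_def N_def Z_def using x xN by blast
  ultimately show ?thesis unfolding N_def by blast
qed

text \<open>Read from its zero term upwards, the derived series stays inside the upper nilpotent
  series, because each of its terms is abelian modulo the next.\<close>

lemma upper_nilpotent_exhausts:
  assumes "lie_solvable F L"
  shows "\<exists>m. upper_nilpotent F L m = carrier L"
proof -
  define D where "D = derived_series F L"
  have D: "lie_ideal F L (D i)" for i unfolding D_def by (rule derived_series_ideal)
  obtain m where m: "D m = {\<zero>\<^bsub>L\<^esub>}" using assms unfolding lie_solvable_def D_def by blast
  have "D (m - i) \<subseteq> upper_nilpotent F L i" if "i \<le> m" for i
    using that
  proof (induction i)
    case 0 then show ?case using m by simp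
  next
    case (Suc i)
    define j where "j = m - Suc i"
    then have mi: "m - i = Suc j" using Suc.prems by simp
    have IH: "D (Suc j) \<subseteq> upper_nilpotent F L i" using Suc unfolding mi by simp
    have "drives L (D j) (D j) (upper_nilpotent F L i)"
    proof (rule drives_step)
      fix a v assume "a \<in> D j" "v \<in> D j"
      then have "a \<otimes>\<^bsub>L\<^esub> v \<in> D (Suc j)" using lie_product_mem by (simp add: D_def)
      then show "a \<otimes>\<^bsub>L\<^esub> v \<in> upper_nilpotent F L i" using IH by blast
    qed
    then show ?case using upper_nilpotent_Suc(3)[OF D] unfolding j_def by blast
  qed
  from this[of m] have "carrier L \<subseteq> upper_nilpotent F L m" by (simp add: D_def)
  then show ?thesis using upper_nilpotent_carrier by blast
qed

lemma upper_nilpotent_sub_lie: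
  assumes U: "lie_subalgebra F L U"
  shows "upper_nilpotent F L i \<inter> U \<subseteq> upper_nilpotent F (sub_lie L U) i"
proof (induction i)
  case 0 then show ?case by simp
next
  case (Suc i)
  interpret S: noetherian_lie_algebra F "sub_lie L U" by (rule sub_lie_noetherian_lie_algebra[OF U])
  have sU: "submodule U F L" "\<And>x y. x \<in> U \<Longrightarrow> y \<in> U \<Longrightarrow> x \<otimes>\<^bsub>L\<^esub> y \<in> U"
    using U unfolding lie_subalgebra_def by auto
  let ?N = "upper_nilpotent F L (Suc i)"
  have ideal: "lie_ideal F (sub_lie L U) (?N \<inter> U)"
    unfolding lie_ideal_def submodule_sub_lie_iff[OF sU(1)]
    using submodule_Int[OF lie_idealD(1)[OF upper_nilpotent_ideal] sU(1)] sU(2)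
      lie_idealD(3)[OF upper_nilpotent_ideal] submoduleD(2)[OF sU(1)] by auto
  obtain n where n: "\<And>xs v. set xs \<subseteq> ?N \<Longrightarrow> length xs = n \<Longrightarrow> v \<in> ?N \<Longrightarrow>
      bracket_word L xs v \<in> upper_nilpotent F L i"
    using upper_nilpotent_Suc(2)[of i] unfolding drives_def by metis
  have "drives L (?N \<inter> U) (?N \<inter> U) (upper_nilpotent F (sub_lie L U) i)"
  proof (rule drivesI)
    fix xs v assume xs: "set xs \<subseteq> ?N \<inter> U" "length xs = n" "v \<in> ?N \<inter> U"
    have "bracket_word L xs v \<in> U" by (rule bracket_word_stable[of U]) (use xs sU in auto)
    moreover have "bracket_word L xs v \<in> upper_nilpotent F L i" using n xs by blast
    ultimately show "bracket_word L xs v \<in> upper_nilpotent F (sub_lie L U) i" using Suc by blast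
  qed
  then show ?case using S.upper_nilpotent_Suc(3)[OF ideal] by simp
qed

end

section \<open>Invariance of the nilradical under derivations\<close>

context lie_algebra
begin

lemma add_pow_one_nonzero:
  assumes "0 < k" "field_char F = 0 \<or> k < field_char F"
  shows "add_pow F k \<one> \<noteq> \<zero>"
proof -
  have A: "group (add_monoid F)" by (rule abelian_group.a_group) unfold_locales
  \<comment> \<open>Characteristic 0 is included: there the claim concerns \<open>0 dvd k\<close>,
    which \<open>0 < k\<close> excludes.\<close>
  have "\<not> field_char F dvd k" using assms by (auto dest: dvd_imp_le)
  then show ?thesis
    unfolding field_char_def add_pow_def using group.pow_eq_id[OF A, of \<one> k] by simp
qed

lemma smult_cancel_mem:
  assumes "submodule U F L" "a \<in> carrier F" "a \<noteq> \<zero>" "x \<in> carrier L" "a \<odot>\<^bsub>L\<^esub> x \<in> U"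
  shows "x \<in> U"
proof -
  have a: "inv a \<in> carrier F" "inv a \<otimes> a = \<one>" using assms field_Units by auto
  have "inv a \<odot>\<^bsub>L\<^esub> (a \<odot>\<^bsub>L\<^esub> x) \<in> U" using submoduleD(6)[OF assms(1) a(1) assms(5)] .
  then show ?thesis using a assms by (simp add: smult_assoc1[symmetric])
qed

text \<open>The sum of all words obtained from \<open>l\<close> by applying \<open>D\<close> to exactly \<open>j\<close> of the letters. Differentiating it
  gives \<open>j + 1\<close> times the sum for \<open>j + 1\<close>, up to words with more undifferentiated letters. Starting from
  words of length \<open>n\<close> that vanish modulo \<open>Z\<close>, this reaches the fully differentiated word, as
  \<open>1, \<dots>, n\<close> are invertible.\<close>

primrec derived_word :: "('a \<Rightarrow> 'a) \<Rightarrow> 'a list \<Rightarrow> nat \<Rightarrow> 'a \<Rightarrow> 'a" where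
  "derived_word D [] j v = (if j = 0 then v else \<zero>\<^bsub>L\<^esub>)"
| "derived_word D (a # l) j v = a \<otimes>\<^bsub>L\<^esub> derived_word D l j v \<oplus>\<^bsub>L\<^esub>
    (case j of 0 \<Rightarrow> \<zero>\<^bsub>L\<^esub> | Suc i \<Rightarrow> D a \<otimes>\<^bsub>L\<^esub> derived_word D l i v)"

context
  fixes D N Z
  assumes D_closed: "\<And>x. x \<in> carrier L \<Longrightarrow> D x \<in> carrier L"
    and D_add: "\<And>x y. x \<in> carrier L \<Longrightarrow> y \<in> carrier L \<Longrightarrow> D (x \<oplus>\<^bsub>L\<^esub> y) = D x \<oplus>\<^bsub>L\<^esub> D y"
    and D_smult: "\<And>a x. a \<in> carrier F \<Longrightarrow> x \<in> carrier L \<Longrightarrow> D (a \<odot>\<^bsub>L\<^esub> x) = a \<odot>\<^bsub>L\<^esub> D x"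
    and D_bracket: "\<And>x y. x \<in> carrier L \<Longrightarrow> y \<in> carrier L \<Longrightarrow>
      D (x \<otimes>\<^bsub>L\<^esub> y) = D x \<otimes>\<^bsub>L\<^esub> y \<oplus>\<^bsub>L\<^esub> x \<otimes>\<^bsub>L\<^esub> D y"
    and N: "lie_ideal F L N" and Z: "lie_ideal F L Z"
    and DZ: "\<And>x. x \<in> Z \<Longrightarrow> D x \<in> Z"
begin

private abbreviation "V \<equiv> power_mod N Z"

private lemma Nc: "a \<in> N \<Longrightarrow> a \<in> carrier L"
  using lie_idealD(2)[OF N] by blast

private lemma V_sub: "submodule (V m) F L"
  by (rule lie_idealD(1)[OF power_mod_ideal[OF N Z]])

private lemma Vc: "v \<in> V m \<Longrightarrow> v \<in> carrier L"
  using submoduleD(2)[OF V_sub] .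

private lemma V_bracket: "x \<in> carrier L \<Longrightarrow> v \<in> V m \<Longrightarrow> x \<otimes>\<^bsub>L\<^esub> v \<in> V m"
  by (rule lie_idealD(3)[OF power_mod_ideal[OF N Z]])

private lemma V_mult: "a \<in> N \<Longrightarrow> v \<in> V m \<Longrightarrow> a \<otimes>\<^bsub>L\<^esub> v \<in> V (Suc m)"
  by (rule power_mod_mult[OF N Z])

private lemma V_le: "m \<le> n \<Longrightarrow> v \<in> V n \<Longrightarrow> v \<in> V m"
  using power_mod_decseq[OF N Z] by blast

private lemma D_zero: "D \<zero>\<^bsub>L\<^esub> = \<zero>\<^bsub>L\<^esub>"
  using D_smult[of \<zero> "\<zero>\<^bsub>L\<^esub>"] D_closed by simp

text \<open>The Leibniz rule hits one factor from \<open>N\<close> at a time. That factor may leave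
  \<open>N\<close>, but the others remain, so at most one level is lost.\<close>

private lemma D_lowers: "v \<in> V (Suc m) \<Longrightarrow> D v \<in> V m"
proof (induction m arbitrary: v)
  case 0
  then show ?case using D_closed[OF Vc[OF 0]] by simp
next
  case (Suc m)
  have "V (Suc (Suc m)) \<subseteq> {v \<in> carrier L. D v \<in> V (Suc m)}"
  proof (rule power_mod_least[OF N Z])
    show "submodule {v \<in> carrier L. D v \<in> V (Suc m)} F L"
      using submoduleD(3,4,6)[OF V_sub[of "Suc m"]]
      by (intro submoduleI') (auto simp: D_zero D_add D_smult simp del: power_mod.simps)
    show "Z \<subseteq> {v \<in> carrier L. D v \<in> V (Suc m)}"
      using DZ power_mod_lower[OF N Z] lie_idealD(2)[OF Z] by blast
    fix a v assume a: "a \<in> N" and v: "v \<in> V (Suc m)"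
    have "D a \<otimes>\<^bsub>L\<^esub> v \<in> V (Suc m)" using V_bracket[OF D_closed[OF Nc[OF a]] v] .
    moreover have "a \<otimes>\<^bsub>L\<^esub> D v \<in> V (Suc m)" using V_mult[OF a Suc.IH[OF v]] .
    ultimately have "D (a \<otimes>\<^bsub>L\<^esub> v) \<in> V (Suc m)"
      unfolding D_bracket[OF Nc[OF a] Vc[OF v]] by (rule submoduleD(4)[OF V_sub])
    then show "a \<otimes>\<^bsub>L\<^esub> v \<in> {v \<in> carrier L. D v \<in> V (Suc m)}"
      using bracket_closed Nc[OF a] Vc[OF v] by blast
  qed
  then show ?case using Suc.prems by blast
qed

private lemma derived_word_closed:
  "set l \<subseteq> N \<Longrightarrow> v \<in> carrier L \<Longrightarrow> derived_word D l j v \<in> carrier L"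
  by (induction l arbitrary: j) (auto split: nat.split simp: Nc D_closed bracket_closed)

private lemma derived_word_0:
  "set l \<subseteq> N \<Longrightarrow> v \<in> carrier L \<Longrightarrow> derived_word D l 0 v = bracket_word L l v"
proof (induction l)
  case (Cons a l)
  have "bracket_word L l v \<in> carrier L" using Cons.prems Nc by (intro bracket_word_closed) auto
  then show ?case using Cons Nc bracket_closed by simp
qed simp

private lemma derived_word_gt:
  "set l \<subseteq> N \<Longrightarrow> v \<in> carrier L \<Longrightarrow> length l < j \<Longrightarrow> derived_word D l j v = \<zero>\<^bsub>L\<^esub>"
  by (induction l arbitrary: j) (auto split: nat.split simp: Nc D_closed)

private lemma derived_word_length:
  "set l \<subseteq> N \<Longrightarrow> v \<in> carrier L \<Longrightarrow> derived_word D l (length l) v = bracket_word L (map D l) v"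
proof (induction l)
  case (Cons a l)
  have "bracket_word L (map D l) v \<in> carrier L"
    using Cons.prems Nc D_closed by (intro bracket_word_closed) auto
  then show ?case using Cons Nc D_closed bracket_closed derived_word_gt by simp
qed simp

text \<open>The \<open>length l - j\<close> letters left alone are in \<open>N\<close> and gain a
  level each; the differentiated ones preserve the levels, which are ideals.\<close>

private lemma derived_word_mem:
  "set l \<subseteq> N \<Longrightarrow> v \<in> V m \<Longrightarrow> derived_word D l j v \<in> V (m + (length l - j))"
proof (induction l arbitrary: j)
  case Nil
  then show ?case using submoduleD(3)[OF V_sub] by (simp del: power_mod.simps)
next
  case (Cons a l)
  have "a \<otimes>\<^bsub>L\<^esub> derived_word D l j v \<in> V (Suc (m + (length l - j)))"
    using Cons by (intro V_mult) auto
  then have 1: "a \<otimes>\<^bsub>L\<^esub> derived_word D l j v \<in> V (m + (length (a # l) - j))"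
    by (rule V_le[rotated]) auto
  have 2: "D a \<otimes>\<^bsub>L\<^esub> derived_word D l i v \<in> V (m + (length (a # l) - j))" if "j = Suc i" for i
    using Cons that by (auto intro: V_bracket D_closed Nc)
  have "(case j of 0 \<Rightarrow> \<zero>\<^bsub>L\<^esub> | Suc i \<Rightarrow> D a \<otimes>\<^bsub>L\<^esub> derived_word D l i v) \<in> V (m + (length (a # l) - j))"
    using 2 submoduleD(3)[OF V_sub] by (cases j) auto
  from submoduleD(4)[OF V_sub 1 this] show ?case by simp
qed

text \<open>A word with \<open>j + 1\<close> differentiated letters arises from \<open>j + 1\<close>
  words with \<open>j\<close> of them, whence the factor. The error \<open>e\<close> collects words
  in which a letter is differentiated twice; these still have \<open>length l - j\<close> letters
  from \<open>N\<close>.\<close>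

private lemma D_derived_word:
  assumes "set l \<subseteq> N" "v \<in> V m"
  shows "\<exists>e\<in>V (m + (length l - j)).
    D (derived_word D l j v) =
      derived_word D l j (D v) \<oplus>\<^bsub>L\<^esub> (add_pow F (Suc j) \<one> \<odot>\<^bsub>L\<^esub> derived_word D l (Suc j) v \<oplus>\<^bsub>L\<^esub> e)"
  using assms(1)
proof (induction l arbitrary: j)
  case Nil
  show ?case
    using submoduleD(3)[OF V_sub] Vc[OF assms(2)] D_closed D_zero
    by (intro bexI[of _ "\<zero>\<^bsub>L\<^esub>"]) auto
next
  case (Cons a l)
  have l: "set l \<subseteq> N" and a: "a \<in> N" using Cons.prems by auto
  have v: "v \<in> carrier L" "D v \<in> carrier L" using Vc[OF assms(2)] D_closed by auto
  note ac = Nc[OF a] D_closed[OF Nc[OF a]] D_closed[OF D_closed[OF Nc[OF a]]]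
  note wc = derived_word_closed[OF l v(1)] derived_word_closed[OF l v(2)]
  define \<kappa> where "\<kappa> = add_pow F j \<one>"
  have \<kappa>: "\<kappa> \<in> carrier F" "add_pow F (Suc j) \<one> = \<kappa> \<oplus> \<one>" unfolding \<kappa>_def by simp_all
  obtain e1 where e1: "e1 \<in> V (m + (length l - j))" and
    eq1: "D (derived_word D l j v) =
      derived_word D l j (D v) \<oplus>\<^bsub>L\<^esub> ((\<kappa> \<oplus> \<one>) \<odot>\<^bsub>L\<^esub> derived_word D l (Suc j) v \<oplus>\<^bsub>L\<^esub> e1)"
    using Cons.IH[OF l, of j] unfolding \<kappa>(2) by blast
  have "a \<otimes>\<^bsub>L\<^esub> e1 \<in> V (Suc (m + (length l - j)))" using V_mult[OF a e1] .
  then have ae1: "a \<otimes>\<^bsub>L\<^esub> e1 \<in> V (m + (length (a # l) - j))" by (rule V_le[rotated]) auto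
  note rules = D_add D_bracket bracket_add_right bracket_add_left bracket_smult_right smult_l_distr
    smult_r_distr bracket_closed
  show ?case
  proof (cases j)
    case 0
    have \<kappa>0: "\<kappa> = \<zero>" unfolding \<kappa>_def 0 by simp
    show ?thesis
      unfolding \<kappa>(2)
      by (rule bexI[OF _ ae1])
        (use 0 eq1 \<kappa>0 ac wc Vc[OF e1] in \<open>simp add: rules M.a_ac\<close>)
  next
    case (Suc i)
    obtain e2 where e2: "e2 \<in> V (m + (length l - i))" and
      eq2: "D (derived_word D l i v) =
        derived_word D l i (D v) \<oplus>\<^bsub>L\<^esub> (\<kappa> \<odot>\<^bsub>L\<^esub> derived_word D l j v \<oplus>\<^bsub>L\<^esub> e2)"
      using Cons.IH[OF l, of i] unfolding \<kappa>_def Suc by blast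
    let ?e = "a \<otimes>\<^bsub>L\<^esub> e1 \<oplus>\<^bsub>L\<^esub> (D (D a) \<otimes>\<^bsub>L\<^esub> derived_word D l i v \<oplus>\<^bsub>L\<^esub> D a \<otimes>\<^bsub>L\<^esub> e2)"
    have len: "length (a # l) - j = length l - i" using Suc by simp
    have "D (D a) \<otimes>\<^bsub>L\<^esub> derived_word D l i v \<in> V (m + (length (a # l) - j))"
      unfolding len by (rule V_bracket[OF ac(3) derived_word_mem[OF l assms(2)]])
    moreover have "D a \<otimes>\<^bsub>L\<^esub> e2 \<in> V (m + (length (a # l) - j))"
      unfolding len by (rule V_bracket[OF ac(2) e2])
    ultimately have e: "?e \<in> V (m + (length (a # l) - j))"
      using ae1 submoduleD(4)[OF V_sub] by blast
    define w q p w' p' where "w = derived_word D l j v" and "q = derived_word D l (Suc j) v"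
      and "p = derived_word D l j (D v)" and "w' = derived_word D l i v"
      and "p' = derived_word D l i (D v)"
    note defs = w_def[symmetric] q_def[symmetric] p_def[symmetric] w'_def[symmetric] p'_def[symmetric]
    have cs: "w \<in> carrier L" "q \<in> carrier L" "p \<in> carrier L" "w' \<in> carrier L" "p' \<in> carrier L"
      unfolding w_def q_def p_def w'_def p'_def using wc by auto
    have "D (a \<otimes>\<^bsub>L\<^esub> w \<oplus>\<^bsub>L\<^esub> D a \<otimes>\<^bsub>L\<^esub> w') =
        (a \<otimes>\<^bsub>L\<^esub> p \<oplus>\<^bsub>L\<^esub> D a \<otimes>\<^bsub>L\<^esub> p') \<oplus>\<^bsub>L\<^esub> ((\<kappa> \<oplus> \<one>) \<odot>\<^bsub>L\<^esub> (a \<otimes>\<^bsub>L\<^esub> q \<oplus>\<^bsub>L\<^esub> D a \<otimes>\<^bsub>L\<^esub> w) \<oplus>\<^bsub>L\<^esub>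
          (a \<otimes>\<^bsub>L\<^esub> e1 \<oplus>\<^bsub>L\<^esub> (D (D a) \<otimes>\<^bsub>L\<^esub> w' \<oplus>\<^bsub>L\<^esub> D a \<otimes>\<^bsub>L\<^esub> e2)))"
      using eq1 eq2 ac cs \<kappa>(1) Vc[OF e1] Vc[OF e2] unfolding defs
      by (simp add: rules M.a_ac)
    moreover have "derived_word D (a # l) j u =
        a \<otimes>\<^bsub>L\<^esub> derived_word D l j u \<oplus>\<^bsub>L\<^esub> D a \<otimes>\<^bsub>L\<^esub> derived_word D l i u"
      "derived_word D (a # l) (Suc j) u =
        a \<otimes>\<^bsub>L\<^esub> derived_word D l (Suc j) u \<oplus>\<^bsub>L\<^esub> D a \<otimes>\<^bsub>L\<^esub> derived_word D l j u" for u
      using Suc by simp_all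
    ultimately show ?thesis
      unfolding \<kappa>(2) using e unfolding defs by (intro bexI[of _ ?e]) (simp_all only: defs)
  qed
qed

text \<open>Take \<open>J\<close> as the sum of \<open>D\<close> N\<open>and\<close>N\<open>. It is
  an ideal since [x, D a] = D [x, a] - [D x, a], and it is nilpotent
  modulo\<close>Z\<open>because long words in\<close>D \<open>N\<close> descend in the filtration
  just as letters from \<open>N\<close> do. If \<open>N\<close> is the largest ideal nilpotent
  modulo \<open>Z\<close>, this gives invariance under \<open>D\<close>.\<close>

lemma derivation_nil_ideal:
  assumes c: "\<And>xs v. set xs \<subseteq> N \<Longrightarrow> length xs = c \<Longrightarrow> v \<in> N \<Longrightarrow> bracket_word L xs v \<in> Z"
    and char: "field_char F = 0 \<or> c < field_char F - 1"
  obtains J where "lie_ideal F L J" "drives L J J Z" "N \<subseteq> J" "D ` N \<subseteq> J"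
proof -
  \<comment> \<open>One letter more than \<open>c\<close>, because the last letter first carries a
    vector of \<open>L\<close> into \<open>N\<close>. In positive characteristic the assumption
    becomes \<open>n < field_char F\<close>.\<close>
  define n where "n = Suc c"
  have n: "bracket_word L xs v \<in> Z" if "set xs \<subseteq> N" "length xs = n" "v \<in> carrier L" for xs v
  proof -
    obtain ys a where ya: "xs = ys @ [a]" "length ys = c"
      using \<open>length xs = n\<close> unfolding n_def by (metis length_append_singleton length_Suc_conv_rev nat.inject)
    then show ?thesis using c[of ys "a \<otimes>\<^bsub>L\<^esub> v"] that lie_idealD(4)[OF N] by simp
  qed
  have main: "derived_word D l j v \<in> V (Suc (m + (n - j)))"
    if l: "set l \<subseteq> N" "length l = n" and "j \<le> n" "v \<in> V m" for l j m v
    using that(3,4)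
  proof (induction j arbitrary: m v)
    case 0
    then have "derived_word D l 0 v \<in> Z"
      using n l Vc derived_word_0 by auto
    then show ?case using power_mod_lower[OF N Z] by blast
  next
    case (Suc j)
    define \<kappa> where "\<kappa> = add_pow F (Suc j) \<one>"
    let ?V = "V (m + (n - j))" and ?w = "derived_word D l (Suc j) v"
    have v: "v \<in> carrier L" using Vc Suc.prems by blast
    obtain e where e: "e \<in> ?V" and
      eq: "D (derived_word D l j v) =
        derived_word D l j (D v) \<oplus>\<^bsub>L\<^esub> (\<kappa> \<odot>\<^bsub>L\<^esub> ?w \<oplus>\<^bsub>L\<^esub> e)"
      using D_derived_word[OF l(1) Suc.prems(2), of j] unfolding l(2) \<kappa>_def by blast
    have 1: "D (derived_word D l j v) \<in> ?V"
      using Suc.IH[of v m] Suc.prems by (intro D_lowers) simp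
    \<comment> \<open>Passing from \<open>v\<close> to \<open>D v\<close> costs a level, which the
      additional one in the induction hypothesis pays for. At \<open>m = 0\<close> nothing is lost
      and that level is dropped.\<close>
    have 2: "derived_word D l j (D v) \<in> ?V"
    proof (cases m)
      case 0
      have "derived_word D l j (D v) \<in> V (Suc (0 + (n - j)))"
        using Suc.prems v D_closed by (intro Suc.IH) auto
      then show ?thesis unfolding 0 by (rule V_le[rotated]) simp
    next
      case (Suc m')
      have "derived_word D l j (D v) \<in> V (Suc (m' + (n - j)))"
        using \<open>Suc j \<le> n\<close> \<open>v \<in> V m\<close> D_lowers unfolding Suc by (intro Suc.IH) auto
      then show ?thesis unfolding Suc by simp
    qed
    have wc: "?w \<in> carrier L" using derived_word_closed[OF l(1) v] .
    have kc: "\<kappa> \<in> carrier F" unfolding \<kappa>_def by simp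
    have "\<kappa> \<odot>\<^bsub>L\<^esub> ?w =
        (\<ominus>\<^bsub>L\<^esub> derived_word D l j (D v) \<oplus>\<^bsub>L\<^esub> D (derived_word D l j v)) \<oplus>\<^bsub>L\<^esub> \<ominus>\<^bsub>L\<^esub> e"
      unfolding eq using Vc[OF e] Vc[OF 2] wc kc by (simp add: M.r_neg1 M.r_neg2 M.a_assoc M.r_neg)
    then have "\<kappa> \<odot>\<^bsub>L\<^esub> ?w \<in> ?V"
      using submoduleD(4,5)[OF V_sub] 1 2 e by simp
    moreover have "\<kappa> \<noteq> \<zero>"
      using char Suc.prems(1) unfolding n_def \<kappa>_def by (intro add_pow_one_nonzero) auto
    ultimately have "?w \<in> ?V" using smult_cancel_mem[OF V_sub kc _ wc] by blast
    moreover have "m + (n - j) = Suc (m + (n - Suc j))" using Suc.prems by simp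
    ultimately show ?case by simp
  qed
  have DN: "D ` N \<subseteq> carrier L" using Nc D_closed by blast
  have "drives L (D ` N \<union> N) (V 0) (V n)"
  proof (rule drives_Un_filtration[where k = n])
    fix m xs v assume xs: "set xs \<subseteq> D ` N" "length xs = n" "v \<in> V m"
    have "xs \<in> map D ` lists N" unfolding lists_image[symmetric] using xs(1) by blast
    then obtain l where l: "set l \<subseteq> N" "xs = map D l" by blast
    then show "bracket_word L xs v \<in> V (Suc m)"
      using main[OF l(1), of n v m] derived_word_length[OF l(1) Vc[OF xs(3)]] xs by simp
  qed (use power_mod_ideal[OF N Z] lie_idealD(2)[OF N] V_mult DN in auto)
  then have dr: "drives L (D ` N \<union> N) (carrier L) Z"
    using power_mod_subset[OF N Z, of n] n by (auto elim: drives_mono)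
  define J where "J = D ` N <+>\<^bsub>L\<^esub> N"
  note sN = submoduleD[OF lie_idealD(1)[OF N]]
  have sDN: "submodule (D ` N) F L"
  proof (rule submoduleI')
    show "\<zero>\<^bsub>L\<^esub> \<in> D ` N" using sN(3) D_zero by (metis imageI)
  qed (use DN sN(2,4,6) in \<open>auto simp: D_add[symmetric] D_smult[symmetric]\<close>)
  note up = set_add_upper[OF sDN lie_idealD(1)[OF N], folded J_def]
  have sJ: "submodule J F L" unfolding J_def using submodule_set_add[OF sDN lie_idealD(1)[OF N]] .
  have "lie_ideal F L J"
    unfolding lie_ideal_def
  proof (intro conjI ballI sJ)
    fix x y assume x: "x \<in> carrier L" and "y \<in> J"
    then obtain a b where ab: "a \<in> N" "b \<in> N" "y = D a \<oplus>\<^bsub>L\<^esub> b" unfolding J_def set_add_iff by blast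
    note abc = Nc[OF ab(1)] D_closed[OF Nc[OF ab(1)]] Nc[OF ab(2)] D_closed[OF x]
    have "x \<otimes>\<^bsub>L\<^esub> D a = D (x \<otimes>\<^bsub>L\<^esub> a) \<oplus>\<^bsub>L\<^esub> \<ominus>\<^bsub>L\<^esub> (D x \<otimes>\<^bsub>L\<^esub> a)"
      using x abc by (simp add: D_bracket bracket_closed M.a_ac M.r_neg M.r_neg1 M.r_neg2)
    moreover have "D (x \<otimes>\<^bsub>L\<^esub> a) \<in> J" "D x \<otimes>\<^bsub>L\<^esub> a \<in> J" "x \<otimes>\<^bsub>L\<^esub> b \<in> J"
      using up x ab abc lie_idealD(3)[OF N] by blast+
    ultimately show "x \<otimes>\<^bsub>L\<^esub> y \<in> J"
      unfolding ab(3) bracket_add_right[OF x abc(2,3)]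
      using submodule_diff[OF sJ] submoduleD(4)[OF sJ] by simp
  qed
  moreover have "drives L J J Z"
    using drives_set_add[OF DN lie_idealD(2)[OF N] subset_refl lie_idealD(1)[OF Z] dr]
      submoduleD(1)[OF sJ] unfolding J_def by (auto elim: drives_mono)
  ultimately show ?thesis using that up by blast
qed

end

end

section \<open>Maximal subalgebras\<close>

context noetherian_lie_algebra
begin

text \<open>Turns the class into a word length. Index c of \<open>lower_central\<close> is the power
  c + 1, and a word of c letters applied to a vector has c + 1 entries, so the two counts
  agree.\<close>

lemma upper_nilpotent_factor_word:
  assumes "lie_nilpotent F (upper_nilpotent_factor F L (Suc k))"
    and xs: "set xs \<subseteq> upper_nilpotent F L (Suc k)" "v \<in> upper_nilpotent F L (Suc k)"
      "length xs = nilpotency_class F (upper_nilpotent_factor F L (Suc k))"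
  shows "bracket_word L xs v \<in> upper_nilpotent F L k"
proof -
  let ?N = "upper_nilpotent F L (Suc k)" and ?Z = "upper_nilpotent F L k"
  let ?Q = "quot_lie (sub_lie L ?N) ?Z"
  interpret S: lie_algebra F "sub_lie L ?N"
    using sub_lie_algebra lie_ideal_is_subalgebra upper_nilpotent_ideal by blast
  have Z: "lie_ideal F (sub_lie L ?N) ?Z"
    using lie_ideal_sub_lie upper_nilpotent_ideal upper_nilpotent_Suc(1) lie_idealD(1) by blast
  interpret Q: lie_algebra F ?Q by (rule S.quot_lie_algebra[OF Z])
  have img: "(\<lambda>x. ?Z +>\<^bsub>sub_lie L ?N\<^esub> x) ` ?N = carrier ?Q"
    using S.quot_lie_simps(1)[OF Z] by simp
  \<comment> \<open>The dictionary speaks of a subalgebra of the quotient; here it is the whole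
    quotient.\<close>
  have all: "sub_lie ?Q (carrier ?Q) = ?Q" unfolding sub_lie_def by simp
  have fac: "upper_nilpotent_factor F L (Suc k) = ?Q" unfolding upper_nilpotent_factor_def by simp
  have "lower_central F ?Q (nilpotency_class F ?Q) = {\<zero>\<^bsub>?Q\<^esub>}"
    using assms(1) unfolding fac nilpotency_class_def lie_nilpotent_def by (rule LeastI_ex)
  then have "lower_central F (sub_lie ?Q (carrier ?Q)) (nilpotency_class F ?Q) = {?Z}"
    using S.quot_lie_simps(2)[OF Z] unfolding all by simp
  moreover have "lie_subalgebra F ?Q (carrier ?Q)"
    using Q.lie_ideal_is_subalgebra Q.lie_ideal_carrier by blast
  ultimately show ?thesis
    using S.lower_central_quot_eq_zero_iff[OF Z, of ?N] xs unfolding img fac by simp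
qed

text \<open>For every x in \<open>L\<close>, ad x restricts to a derivation of \<open>K\<close>, and
  it preserves \<open>Z\<close> because \<open>Z\<close> is a term of the series of \<open>L\<close>
  by induction. So the next term of \<open>K\<close> is invariant under ad x, hence a nilpotent
  ideal of \<open>L\<close> modulo \<open>Z\<close>.\<close>

lemma upper_nilpotent_regular_ideal:
  assumes K: "lie_ideal F L K" and r: "upper_nilpotent F L r \<subseteq> K"
    and reg: "\<And>k. k < r \<Longrightarrow> field_char F > 0 \<Longrightarrow>
      lie_nilpotent F (upper_nilpotent_factor F (sub_lie L K) (Suc k)) \<and>
      nilpotency_class F (upper_nilpotent_factor F (sub_lie L K) (Suc k)) < field_char F - 1"
  shows "k \<le> r \<Longrightarrow> upper_nilpotent F (sub_lie L K) k = upper_nilpotent F L k"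
proof (induction k)
  case 0 then show ?case by simp
next
  case (Suc k)
  interpret S: noetherian_lie_algebra F "sub_lie L K"
    by (rule sub_lie_noetherian_lie_algebra[OF lie_ideal_is_subalgebra[OF K]])
  define N Z where "N = upper_nilpotent F (sub_lie L K) (Suc k)" and "Z = upper_nilpotent F L k"
  have Z: "Z = upper_nilpotent F (sub_lie L K) k" using Suc unfolding Z_def by simp
  have sK: "submodule K F L" "K \<subseteq> carrier L" using lie_idealD[OF K] by auto
  have N: "lie_ideal F (sub_lie L K) N" unfolding N_def by (rule S.upper_nilpotent_ideal)
  have NK: "N \<subseteq> K" using S.lie_idealD(2)[OF N] by simp
  have iZ: "lie_ideal F (sub_lie L K) Z" unfolding Z by (rule S.upper_nilpotent_ideal)
  \<comment> \<open>In characteristic 0 any sufficient length will do; otherwise the class is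
    chosen, as the hypothesis bounds it.\<close>
  obtain c where c: "\<And>xs v. set xs \<subseteq> N \<Longrightarrow> length xs = c \<Longrightarrow> v \<in> N \<Longrightarrow> bracket_word L xs v \<in> Z"
    and char: "field_char F = 0 \<or> c < field_char F - 1"
  proof (cases "field_char F = 0")
    case True
    then show ?thesis
      using that S.upper_nilpotent_Suc(2)[of k] unfolding N_def Z drives_def by auto
  next
    case False
    then show ?thesis
      using that S.upper_nilpotent_factor_word[of k] reg[of k] Suc.prems unfolding N_def Z by auto
  qed
  have "x \<otimes>\<^bsub>L\<^esub> y \<in> N" if x: "x \<in> carrier L" and y: "y \<in> N" for x y
  proof -
    have cl: "a \<in> carrier L" if "a \<in> K" for a using that sK(2) by blast
    obtain J where J: "lie_ideal F (sub_lie L K) J" "drives (sub_lie L K) J J Z"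
      "(\<lambda>y. x \<otimes>\<^bsub>L\<^esub> y) ` N \<subseteq> J"
    proof (rule S.derivation_nil_ideal[of "\<lambda>y. x \<otimes>\<^bsub>L\<^esub> y" N Z c])
      show "x \<otimes>\<^bsub>L\<^esub> (a \<otimes>\<^bsub>sub_lie L K\<^esub> b) =
          (x \<otimes>\<^bsub>L\<^esub> a) \<otimes>\<^bsub>sub_lie L K\<^esub> b \<oplus>\<^bsub>sub_lie L K\<^esub> a \<otimes>\<^bsub>sub_lie L K\<^esub> (x \<otimes>\<^bsub>L\<^esub> b)"
        if "a \<in> carrier (sub_lie L K)" "b \<in> carrier (sub_lie L K)" for a b
        using bracket_leibniz[OF x cl cl] that by simp
      show "x \<otimes>\<^bsub>L\<^esub> a \<in> Z" if "a \<in> Z" for a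
        using that x lie_idealD(3)[OF upper_nilpotent_ideal] unfolding Z_def by blast
      show "lie_ideal F (sub_lie L K) N" "lie_ideal F (sub_lie L K) Z" by fact+
      show "field_char F = 0 \<or> c < field_char F - 1" by fact
    qed (use x cl c lie_idealD(3)[OF K] that in
        \<open>auto simp: bracket_add_right bracket_smult_right\<close>)
    then have "J \<subseteq> N" using S.upper_nilpotent_Suc(3)[OF J(1)] unfolding N_def Z by simp
    then show ?thesis using J(3) y by blast
  qed
  then have "lie_ideal F L N"
    using N submodule_sub_lie_iff[OF sK(1)] unfolding lie_ideal_def by blast
  moreover have "drives L N N Z" using S.upper_nilpotent_Suc(2)[of k] unfolding N_def Z by simp
  ultimately have "N \<subseteq> upper_nilpotent F L (Suc k)" using upper_nilpotent_Suc(3) unfolding Z_def by blast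
  moreover have "upper_nilpotent F L (Suc k) \<subseteq> N"
    using upper_nilpotent_sub_lie[OF lie_ideal_is_subalgebra[OF K], of "Suc k"]
      upper_nilpotent_mono[OF Suc.prems] r unfolding N_def by blast
  ultimately show ?case unfolding N_def by blast
qed

section \<open>Subalgebras supplemented by an ideal\<close>

lemma lie_subalgebra_add_ideal:
  assumes "lie_subalgebra F L M" "lie_ideal F L P"
  shows "lie_subalgebra F L (M <+>\<^bsub>L\<^esub> P)"
  unfolding lie_subalgebra_def
proof (intro conjI ballI)
  have M: "submodule M F L" "\<And>x y. x \<in> M \<Longrightarrow> y \<in> M \<Longrightarrow> x \<otimes>\<^bsub>L\<^esub> y \<in> M"
    using assms(1) unfolding lie_subalgebra_def by auto
  note P = lie_idealD[OF assms(2)]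
  show "submodule (M <+>\<^bsub>L\<^esub> P) F L" using M(1) P(1) by (rule submodule_set_add)
  fix x y assume "x \<in> M <+>\<^bsub>L\<^esub> P" "y \<in> M <+>\<^bsub>L\<^esub> P"
  then obtain m p n q where *: "m \<in> M" "n \<in> M" "p \<in> P" "q \<in> P" "x = m \<oplus>\<^bsub>L\<^esub> p" "y = n \<oplus>\<^bsub>L\<^esub> q"
    unfolding set_add_iff by blast
  have c: "m \<in> carrier L" "n \<in> carrier L" "p \<in> carrier L" "q \<in> carrier L"
    using * submoduleD(2)[OF M(1)] P(2) by auto
  have "x \<otimes>\<^bsub>L\<^esub> y = m \<otimes>\<^bsub>L\<^esub> n \<oplus>\<^bsub>L\<^esub> (m \<otimes>\<^bsub>L\<^esub> q \<oplus>\<^bsub>L\<^esub> p \<otimes>\<^bsub>L\<^esub> y)"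
    using * c by (simp add: bracket_add_left bracket_add_right bracket_closed M.a_ac)
  moreover have "m \<otimes>\<^bsub>L\<^esub> q \<oplus>\<^bsub>L\<^esub> p \<otimes>\<^bsub>L\<^esub> y \<in> P"
    using * c P(3)[OF c(1) *(4)] P(4)[OF *(3), of y] submoduleD(4)[OF P(1)] by simp
  ultimately show "x \<otimes>\<^bsub>L\<^esub> y \<in> M <+>\<^bsub>L\<^esub> P" unfolding set_add_iff using M(2) * by blast
qed

text \<open>Write an element of \<open>L\<close> as m + p: m maps \<open>B\<close> to itself, and p
  maps it into \<open>P\<close>.\<close>

lemma lie_ideal_add_supplement:
  assumes M: "lie_subalgebra F L M" and P: "lie_ideal F L P" and MP: "M <+>\<^bsub>L\<^esub> P = carrier L"
    and B: "lie_ideal F (sub_lie L M) B"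
  shows "lie_ideal F L (B <+>\<^bsub>L\<^esub> P)"
  unfolding lie_ideal_def
proof (intro conjI ballI)
  interpret S: lie_algebra F "sub_lie L M" by (rule sub_lie_algebra[OF M])
  have sM: "submodule M F L" using M unfolding lie_subalgebra_def by blast
  have sB: "submodule B F L" "B \<subseteq> M"
    using S.lie_idealD(1)[OF B] submodule_sub_lie_iff[OF sM] by auto
  note P' = lie_idealD[OF P]
  show "submodule (B <+>\<^bsub>L\<^esub> P) F L" using sB(1) P'(1) by (rule submodule_set_add)
  fix x y assume x: "x \<in> carrier L" and "y \<in> B <+>\<^bsub>L\<^esub> P"
  then obtain b q where y: "b \<in> B" "q \<in> P" "y = b \<oplus>\<^bsub>L\<^esub> q" unfolding set_add_iff by blast
  obtain m p where x': "m \<in> M" "p \<in> P" "x = m \<oplus>\<^bsub>L\<^esub> p" using x MP set_add_iff by blast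
  have c: "m \<in> carrier L" "b \<in> carrier L" "p \<in> carrier L" "q \<in> carrier L"
    using x' y sB submoduleD(2)[OF sM] P'(2) by auto
  have "x \<otimes>\<^bsub>L\<^esub> y = m \<otimes>\<^bsub>L\<^esub> b \<oplus>\<^bsub>L\<^esub> (p \<otimes>\<^bsub>L\<^esub> b \<oplus>\<^bsub>L\<^esub> x \<otimes>\<^bsub>L\<^esub> q)"
    using x' y c by (simp add: bracket_add_left bracket_add_right bracket_closed M.a_ac)
  moreover have "p \<otimes>\<^bsub>L\<^esub> b \<oplus>\<^bsub>L\<^esub> x \<otimes>\<^bsub>L\<^esub> q \<in> P"
    using c P'(3)[OF x y(2)] P'(4)[OF x'(2) c(2)] submoduleD(4)[OF P'(1)] by simp
  moreover have "m \<otimes>\<^bsub>L\<^esub> b \<in> B" using S.lie_idealD(3)[OF B, of m b] x' y by simp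
  ultimately show "x \<otimes>\<^bsub>L\<^esub> y \<in> B <+>\<^bsub>L\<^esub> P" unfolding set_add_iff by blast
qed

text \<open>\<open>B\<close> is merely an ideal of \<open>M\<close>. Adding the supplement makes it
  an ideal of \<open>L\<close> and keeps it nilpotent modulo the previous term, so maximality of
  that term applies.\<close>

lemma supplement_upper_nilpotent:
  assumes M: "lie_subalgebra F L M" and MP: "M <+>\<^bsub>L\<^esub> upper_nilpotent F L (Suc i) = carrier L"
    and B: "lie_ideal F (sub_lie L M) B" and dr: "drives L B (carrier L) (upper_nilpotent F L i)"
  shows "B \<subseteq> upper_nilpotent F L (Suc i)"
proof -
  let ?P = "upper_nilpotent F L (Suc i)"
  interpret S: lie_algebra F "sub_lie L M" by (rule sub_lie_algebra[OF M])
  have sM: "submodule M F L" using M unfolding lie_subalgebra_def by blast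
  have sB: "submodule B F L"
    using S.lie_idealD(1)[OF B] submodule_sub_lie_iff[OF sM] by auto
  have I: "lie_ideal F L (B <+>\<^bsub>L\<^esub> ?P)"
    by (rule lie_ideal_add_supplement[OF M upper_nilpotent_ideal MP B])
  have "drives L (B <+>\<^bsub>L\<^esub> ?P) (carrier L) (upper_nilpotent F L i)"
    by (rule drives_ideal_add[OF upper_nilpotent_ideal upper_nilpotent_ideal
          submoduleD(1)[OF sB] dr upper_nilpotent_Suc(2)])
  then have "drives L (B <+>\<^bsub>L\<^esub> ?P) (B <+>\<^bsub>L\<^esub> ?P) (upper_nilpotent F L i)"
    using lie_idealD(2)[OF I] by (auto elim: drives_mono)
  then have "B <+>\<^bsub>L\<^esub> ?P \<subseteq> ?P" using upper_nilpotent_Suc(3) I by blast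
  then show ?thesis using set_add_upper(1)[OF sB lie_idealD(1)[OF upper_nilpotent_ideal]] by blast
qed

lemma lie_core_greatest:
  assumes M: "submodule M F L"
  shows "lie_ideal F L (lie_core F L M)" "lie_core F L M \<subseteq> M"
    "lie_ideal F L I \<Longrightarrow> I \<subseteq> M \<Longrightarrow> I \<subseteq> lie_core F L M"
proof -
  define P where "P I \<longleftrightarrow> lie_ideal F L I \<and> I \<subseteq> M" for I
  have P0: "P {\<zero>\<^bsub>L\<^esub>}" unfolding P_def using lie_ideal_zero submoduleD(3)[OF M] by blast
  have Psub: "submodule U F L" if "P U" for U using that lie_idealD(1) unfolding P_def by blast
  have Padd: "P (U <+>\<^bsub>L\<^esub> V)" if "P U" "P V" for U V
    using that lie_ideal_set_add set_add_least[OF M] unfolding P_def by blast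
  obtain W where W: "P W" "\<And>U. P U \<Longrightarrow> U \<subseteq> W"
    using noetherian_greatest[OF noetherian, of P, OF P0 Psub Padd] by blast
  have "lie_core F L M = W"
    unfolding lie_core_def P_def[symmetric] using W by (rule Greatest_equality)
  then show "lie_ideal F L (lie_core F L M)" "lie_core F L M \<subseteq> M"
    "lie_ideal F L I \<Longrightarrow> I \<subseteq> M \<Longrightarrow> I \<subseteq> lie_core F L M"
    using W unfolding P_def by auto
qed

text \<open>Intersecting the series of \<open>L\<close> with \<open>U\<close> shows that the series
  of \<open>U\<close> reaches \<open>U\<close>; thus the \<open>LEAST\<close> in its length is
  attained.\<close>

lemma nilpotent_length_sub_lie_le:
  assumes "lie_solvable F L" "lie_subalgebra F L U"
  shows "upper_nilpotent F (sub_lie L U) (nilpotent_length F (sub_lie L U)) = U"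
    "nilpotent_length F (sub_lie L U) \<le> nilpotent_length F L"
proof -
  interpret S: noetherian_lie_algebra F "sub_lie L U" by (rule sub_lie_noetherian_lie_algebra[OF assms(2)])
  have "upper_nilpotent F L (nilpotent_length F L) = carrier L"
    unfolding nilpotent_length_def using upper_nilpotent_exhausts[OF assms(1)] by (rule LeastI_ex)
  then have "U \<subseteq> upper_nilpotent F (sub_lie L U) (nilpotent_length F L)"
    using upper_nilpotent_sub_lie[OF assms(2)] assms(2) submoduleD(1)
    unfolding lie_subalgebra_def by blast
  then have eq: "upper_nilpotent F (sub_lie L U) (nilpotent_length F L) = carrier (sub_lie L U)"
    using S.upper_nilpotent_carrier by auto
  show "nilpotent_length F (sub_lie L U) \<le> nilpotent_length F L"
    unfolding nilpotent_length_def[of F "sub_lie L U"] using eq by (rule Least_le)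
  have "upper_nilpotent F (sub_lie L U) (nilpotent_length F (sub_lie L U)) = carrier (sub_lie L U)"
    unfolding nilpotent_length_def[of F "sub_lie L U"] using eq by (rule LeastI)
  then show "upper_nilpotent F (sub_lie L U) (nilpotent_length F (sub_lie L U)) = U" by simp
qed

lemma nilpotent_length_maximal_ge:
  assumes solv: "lie_solvable F L" and max: "maximal_subalgebra F L M"
    and reg: "strongly_nilregular F L (lie_core F L M)"
  shows "nilpotent_length F L \<le> Suc (nilpotent_length F (sub_lie L M))"
proof -
  define K where "K = lie_core F L M"
  define N where "N = upper_nilpotent F L"
  define NM where "NM = upper_nilpotent F (sub_lie L M)"
  define NK where "NK = upper_nilpotent F (sub_lie L K)"
  define r where "r = compatibility_index F L K"
  define m where "m = nilpotent_length F (sub_lie L M)"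
  have M: "lie_subalgebra F L M" "M \<noteq> carrier L"
    and maxM: "\<And>U. lie_subalgebra F L U \<Longrightarrow> M \<subseteq> U \<Longrightarrow> U = M \<or> U = carrier L"
    using max unfolding maximal_subalgebra_def by auto
  have sM: "submodule M F L" using M unfolding lie_subalgebra_def by blast
  note core = lie_core_greatest[OF sM, folded K_def]
  have sK: "submodule K F L" using lie_idealD(1)[OF core(1)] .
  interpret SM: noetherian_lie_algebra F "sub_lie L M" by (rule sub_lie_noetherian_lie_algebra[OF M(1)])
  interpret SK: noetherian_lie_algebra F "sub_lie L K"
    by (rule sub_lie_noetherian_lie_algebra[OF lie_ideal_is_subalgebra[OF core(1)]])
  have iN: "lie_ideal F L (N i)" for i unfolding N_def by (rule upper_nilpotent_ideal)
  have iM: "lie_ideal F (sub_lie L M) (NM i)" for i unfolding NM_def by (rule SM.upper_nilpotent_ideal)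
  have Nmono: "i \<le> j \<Longrightarrow> N i \<subseteq> N j" for i j unfolding N_def by (rule upper_nilpotent_mono)
  have NM_M: "NM i \<subseteq> M" for i using SM.lie_idealD(2)[OF iM] by simp
  have Mc: "M \<subseteq> carrier L" using submoduleD(1)[OF sM] .
  obtain t where t: "N t = carrier L" unfolding N_def using upper_nilpotent_exhausts[OF solv] by blast
  have KL: "K \<noteq> carrier L" using core(2) M(2) Mc by blast
  \<comment> \<open>\<open>GREATEST\<close> on numbers needs a bound: the series reaches
    \<open>L\<close> at \<open>t\<close>, and \<open>K\<close> is proper.\<close>
  have bound: "\<forall>i. N i \<subseteq> K \<longrightarrow> i \<le> t"
    using t KL Nmono lie_idealD(2)[OF core(1)] by (metis nat_le_linear subset_antisym subset_trans)
  have "N 0 \<subseteq> K" unfolding N_def using submoduleD(3)[OF sK] by simp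
  then have r: "N r \<subseteq> K" and rmax: "\<And>i. N i \<subseteq> K \<Longrightarrow> i \<le> r"
    unfolding r_def compatibility_index_def N_def[symmetric]
    using GreatestI_nat[of "\<lambda>i. N i \<subseteq> K" 0 t] Greatest_le_nat[of "\<lambda>i. N i \<subseteq> K" _ t] bound by auto
  define P where "P = N (Suc r)"
  \<comment> \<open>An ideal inside \<open>M\<close> lies in the core, so
    \<open>P \<subseteq> M\<close> would contradict the maximality of \<open>r\<close>.\<close>
  have PM: "\<not> P \<subseteq> M" unfolding P_def using core(3)[OF iN] rmax[of "Suc r"] by auto
  have MP: "M <+>\<^bsub>L\<^esub> P = carrier L"
    using maxM[OF lie_subalgebra_add_ideal[OF M(1) iN]] PM set_add_upper[OF sM lie_idealD(1)[OF iN]]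
    unfolding P_def by blast
  have MN: "M <+>\<^bsub>L\<^esub> N i = carrier L" if "Suc r \<le> i" for i
  proof -
    have "M <+>\<^bsub>L\<^esub> P \<subseteq> M <+>\<^bsub>L\<^esub> N i"
      unfolding subset_iff set_add_iff P_def using Nmono[OF that] by blast
    then show ?thesis
      using MP set_add_least[OF carrier_is_submodule Mc lie_idealD(2)[OF iN[of i]]] by blast
  qed
  have NK_eq: "NK i = N i" if "i \<le> r" for i
    unfolding NK_def N_def
  proof (rule upper_nilpotent_regular_ideal[OF core(1) _ _ that])
    show "upper_nilpotent F L r \<subseteq> K" using r unfolding N_def .
    fix k assume "k < r" "field_char F > 0"
    then show "lie_nilpotent F (upper_nilpotent_factor F (sub_lie L K) (Suc k)) \<and>
      nilpotency_class F (upper_nilpotent_factor F (sub_lie L K) (Suc k)) < field_char F - 1"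
      using reg unfolding strongly_nilregular_def K_def[symmetric] r_def[symmetric] by auto
  qed
  have N_NM: "N i \<subseteq> NM i" if "i \<le> r" for i
    using upper_nilpotent_sub_lie[OF M(1), of i] Nmono[OF that] r core(2)
    unfolding N_def NM_def by blast
  have NM_words: "drives L (NM (Suc i)) (NM (Suc i)) (NM i)" for i
    using SM.upper_nilpotent_Suc(2) unfolding NM_def by simp
  \<comment> \<open>Strictly below \<open>r\<close>, because level \<open>Suc i\<close> is settled
    by brackets with \<open>N (Suc (Suc i))\<close>, which has to lie in \<open>K\<close>.\<close>
  have low: "NM i = N i" if "i < r" for i
    using that
  proof (induction i)
    case 0 then show ?case unfolding NM_def N_def by simp
  next
    case (Suc i)
    let ?B = "NM (Suc i)"
    have IH: "NM i = N i" "NK i = N i" using Suc NK_eq by auto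
    have BK: "lie_ideal F (sub_lie L K) (?B \<inter> K)"
      unfolding lie_ideal_def submodule_sub_lie_iff[OF sK]
    proof (intro conjI ballI)
      have "submodule ?B F L" using SM.lie_idealD(1)[OF iM] submodule_sub_lie_iff[OF sM] by blast
      then show "submodule (?B \<inter> K) F L" using sK by (rule submodule_Int)
      fix x y assume x: "x \<in> carrier (sub_lie L K)" and y: "y \<in> ?B \<inter> K"
      have "x \<otimes>\<^bsub>L\<^esub> y \<in> ?B" using SM.lie_idealD(3)[OF iM, of x y] x y core(2) by auto
      moreover have "x \<otimes>\<^bsub>L\<^esub> y \<in> K" using x y lie_idealD(3)[OF core(1)] submoduleD(2)[OF sK] by auto
      ultimately show "x \<otimes>\<^bsub>sub_lie L K\<^esub> y \<in> ?B \<inter> K" by simp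
    qed auto
    have "drives L (?B \<inter> K) (?B \<inter> K) (NK i)"
      using NM_words[of i] unfolding IH by (auto elim: drives_mono)
    then have BN: "?B \<inter> K \<subseteq> N (Suc i)"
      using SK.upper_nilpotent_Suc(3)[OF BK, of i] NK_eq[of "Suc i"] Suc.prems unfolding NK_def by simp
    have PK: "N (Suc (Suc i)) \<subseteq> K" using Nmono[of "Suc (Suc i)" r] r Suc.prems by auto
    \<comment> \<open>Brackets with the next term fall into \<open>?B \<inter> K\<close>, so
      \<open>b\<close> centralizes a factor and lies in \<open>N (Suc (Suc i))\<close>. This places
      \<open>?B\<close> inside \<open>K\<close>, and \<open>BN\<close> then improves the inclusion
      by one level.\<close>
    have "?B \<subseteq> N (Suc (Suc i))"
    proof
      fix b assume b: "b \<in> ?B"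
      have "b \<otimes>\<^bsub>L\<^esub> y \<in> N (Suc i)" if y: "y \<in> N (Suc (Suc i))" for y
      proof -
        have "y \<in> M" "b \<in> carrier L" using y b PK core(2) NM_M[of "Suc i"] Mc by blast+
        then have "b \<otimes>\<^bsub>L\<^esub> y \<in> ?B" "b \<otimes>\<^bsub>L\<^esub> y \<in> N (Suc (Suc i))"
          using SM.lie_idealD(4)[OF iM, of b _ y] b y lie_idealD(3)[OF iN] by auto
        then show ?thesis using BN PK by blast
      qed
      then show "b \<in> N (Suc (Suc i))"
        using upper_nilpotent_centralizer[OF solv, of b] b NM_M Mc unfolding N_def by blast
    qed
    then show ?case using BN PK N_NM[of "Suc i"] Suc.prems by auto
  qed
  have at_r: "NM r \<subseteq> P"
  proof (cases r)
    case 0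
    have "NM 0 = N 0" unfolding NM_def N_def by simp
    then show ?thesis using Nmono[of 0 1] unfolding P_def 0 by simp
  next
    case (Suc s)
    have B: "NM r \<subseteq> carrier L" using NM_M Mc by blast
    have "drives L (NM r) (N r) (N s)"
      using NM_words[of s] N_NM[of r] low[of s] unfolding Suc by (auto elim: drives_mono)
    from drives_centralizer[OF iN iN _ B this]
    have "drives L (NM r) (carrier L) {x \<in> carrier L. \<forall>y\<in>N r. x \<otimes>\<^bsub>L\<^esub> y \<in> N s}"
      using Nmono[of s r] Suc by simp
    moreover have "{x \<in> carrier L. \<forall>y\<in>N r. x \<otimes>\<^bsub>L\<^esub> y \<in> N s} \<subseteq> N r"
      using upper_nilpotent_centralizer[OF solv] unfolding N_def Suc by blast
    ultimately have "drives L (NM r) (carrier L) (N r)" by (auto elim: drives_mono)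
    then show ?thesis
      using supplement_upper_nilpotent[OF M(1) _ iM] MP unfolding P_def N_def by blast
  qed
  have high: "NM (r + j) \<subseteq> N (Suc r + j)" for j
  proof (induction j)
    case 0 then show ?case using at_r unfolding P_def by simp
  next
    case (Suc j)
    let ?B = "NM (Suc (r + j))" and ?Z = "N (Suc r + j)"
    obtain n where n: "\<And>xs v. set xs \<subseteq> ?B \<Longrightarrow> length xs = n \<Longrightarrow> v \<in> ?B \<Longrightarrow> bracket_word L xs v \<in> NM (r + j)"
      using NM_words[of "r + j"] unfolding drives_def by metis
    have Bc: "?B \<subseteq> carrier L" using NM_M Mc by blast
    have "drives L ?B (?B <+>\<^bsub>L\<^esub> ?Z) ?Z"
    proof (rule drivesI)
      fix xs v assume xs: "set xs \<subseteq> ?B" "length xs = n" and "v \<in> ?B <+>\<^bsub>L\<^esub> ?Z"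
      then obtain b z where v: "b \<in> ?B" "z \<in> ?Z" "v = b \<oplus>\<^bsub>L\<^esub> z" unfolding set_add_iff by blast
      have c: "set xs \<subseteq> carrier L" "b \<in> carrier L" "z \<in> carrier L"
        using xs v Bc lie_idealD(2)[OF iN] by auto
      have "bracket_word L xs b \<in> ?Z" using n[OF xs v(1)] Suc by blast
      moreover have "bracket_word L xs z \<in> ?Z" using bracket_word_ideal[OF iN c(1) v(2)] .
      ultimately show "bracket_word L xs v \<in> ?Z"
        unfolding v(3) bracket_word_add[OF c] using submoduleD(4)[OF lie_idealD(1)[OF iN]] by blast
    qed
    moreover have "drives L ?B (carrier L) (?B <+>\<^bsub>L\<^esub> ?Z)"
    \<comment> \<open>Split \<open>x\<close> along \<open>M\<close> and \<open>?Z\<close>: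
      bracketing with the first part stays in \<open>?B\<close>, an ideal of \<open>M\<close>, and
      with the second in \<open>?Z\<close>.\<close>
    proof (rule drives_step)
      fix b x assume b: "b \<in> ?B" and "x \<in> carrier L"
      then obtain u z where x: "u \<in> M" "z \<in> ?Z" "x = u \<oplus>\<^bsub>L\<^esub> z"
        using MN[of "Suc r + j"] set_add_iff by (metis le_add1)
      have "b \<otimes>\<^bsub>L\<^esub> u \<in> ?B" using SM.lie_idealD(4)[OF iM, of b _ u] b x(1) by simp
      moreover have "b \<otimes>\<^bsub>L\<^esub> z \<in> ?Z" using lie_idealD(3)[OF iN] b Bc x(2) by blast
      moreover have "b \<otimes>\<^bsub>L\<^esub> x = b \<otimes>\<^bsub>L\<^esub> u \<oplus>\<^bsub>L\<^esub> b \<otimes>\<^bsub>L\<^esub> z"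
        unfolding x(3) using b Bc x(1) Mc x(2) lie_idealD(2)[OF iN] by (intro bracket_add_right) auto
      ultimately show "b \<otimes>\<^bsub>L\<^esub> x \<in> ?B <+>\<^bsub>L\<^esub> ?Z" unfolding set_add_iff by blast
    qed
    ultimately have "drives L ?B (carrier L) ?Z" by (rule drives_trans[rotated])
    then have "?B \<subseteq> N (Suc (Suc r + j))"
      using supplement_upper_nilpotent[OF M(1) _ iM] MN[of "Suc (Suc r + j)"] unfolding N_def by auto
    then show ?case by simp
  qed
  have NMm: "NM m = M" unfolding NM_def m_def by (rule nilpotent_length_sub_lie_le(1)[OF solv M(1)])
  have "N (Suc m) = carrier L"
  proof (cases "r \<le> m")
    case True
    have "M \<subseteq> N (Suc m)" using high[of "m - r"] NMm True by simp
    then have "carrier L \<subseteq> N (Suc m)"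
      using set_add_least[OF lie_idealD(1)[OF iN[of "Suc m"]] _ Nmono[of "Suc r" "Suc m"]] MP True
      unfolding P_def by auto
    then show ?thesis using lie_idealD(2)[OF iN] by blast
  next
    \<comment> \<open>Here \<open>M\<close> would equal \<open>N m\<close> and contain
      \<open>N (Suc m)\<close>, making that factor zero and centralized by all of \<open>L\<close>.
      The result contradicts \<open>M\<close> being proper, so the case is void, but the goal
      follows directly.\<close>
    case False
    then have "N (Suc m) \<subseteq> M" using Nmono[of "Suc m" r] r core(2) by auto
    moreover have Nm: "N m = M" using low[of m] NMm False by simp
    ultimately have "carrier L \<subseteq> N (Suc m)"
      using upper_nilpotent_centralizer[OF solv] lie_idealD(3)[OF iN[of m]] unfolding N_def by blast
    then show ?thesis using lie_idealD(2)[OF iN] by blast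
  qed
  then show ?thesis
    unfolding nilpotent_length_def[of F L] m_def[symmetric] N_def by (rule Least_le)
qed

end

theorem proposition2p13:
  fixes F :: "('k, 'm) ring_scheme" and L :: "('k, 'a) module" and M :: "'a set"
  assumes "lie_algebra F L"
    and "finite_dimensional F L"
    and "lie_solvable F L"
    and "maximal_subalgebra F L M"
    and "strongly_nilregular F L (lie_core F L M)"
  shows "\<exists>i\<in>{0, 1}. int (nilpotent_length F (sub_lie L M)) = int (nilpotent_length F L) - i"
proof -
  interpret lie_algebra F L by fact
  interpret noetherian_lie_algebra F L
    using finite_dimensional_noetherian[OF assms(2)] by unfold_locales
  have "nilpotent_length F (sub_lie L M) \<le> nilpotent_length F L"
    using nilpotent_length_sub_lie_le(2) assms(3,4) unfolding maximal_subalgebra_def by blast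
  moreover have "nilpotent_length F L \<le> Suc (nilpotent_length F (sub_lie L M))"
    using nilpotent_length_maximal_ge assms(3-5) by blast
  ultimately show ?thesis by auto
qed

end
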